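(* Let $P\in\mathbb Q[X;\mathbb N]$ and let $R_0$ be an equicharacteristic Artinian local ring. Then the following conditions are equivalent: (i) There exists a standard $R_0$-algebra $S$ such that $h_S=P$. (ii) $P$ admits a Gotzmann development.
   Context: $\mathbb N$ includes $0$. $\mathbb Q[X;\mathbb N]=\{P\in\mathbb Q[X]\mid P(n)\in\mathbb N\text{ for }n\gg0\}$. A local ring is equicharacteristic if it has the same characteristic as its residue field. A standard $R_0$-algebra is a graded algebra $S=R_0[X_1,\dots,X_b]/I$ for some $b\ge1$, where $\deg X_i=1$ and $I$ is a homogeneous ideal contained in the ideal $R_+$ of elements of $R=R_0[X_1,\dots,X_b]$ with zero degree-$0$ component. Its Hilbert function is $H_S(n)=\lambda_{R_0}(S_n)$ (length), and its Hilbert polynomial $h_S\in\mathbb Q[X]$ is the polynomial with $h_S(n)=H_S(n)$ for $n\gg0$. A polynomial $P\in\mathbb Q[X;\mathbb N]$ admits a Gotzmann development if either $P=0$ or there exist integers $c_1\ge c_2\ge\dots\ge c_s\ge0$ such that $P(n)=\binom{n+c_1}{c_1}+\binom{n+c_2-1}{c_2}+\dots+\binom{n+c_s-(s-1)}{c_s}$ for all $n\gg0$. *)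

theory Defs
  imports
    "HOL-Algebra.Algebraic_Closure_Type"
    "HOL-Algebra.QuotRing"
    "HOL-Algebra.Module"
    "HOL-Library.Poly_Mapping"
    "HOL-Library.Extended_Nat"
begin

section \<open>Equicharacteristic Artinian local rings\<close>

locale local_ring = cring +
  assumes unique_maximalideal: "\<exists>!M. maximalideal M R"

definition residue_field :: "('a, 'b) ring_scheme \<Rightarrow> 'a set ring" where
  "residue_field R = R Quot (THE M. maximalideal M R)"

definition ring_characteristic :: "('a, 'b) ring_scheme \<Rightarrow> nat" where
  "ring_characteristic R =
    (if \<exists>n::nat. n > 0 \<and> [n] \<cdot>\<^bsub>R\<^esub> \<one>\<^bsub>R\<^esub> = \<zero>\<^bsub>R\<^esub>
     then LEAST n::nat. n > 0 \<and> [n] \<cdot>\<^bsub>R\<^esub> \<one>\<^bsub>R\<^esub> = \<zero>\<^bsub>R\<^esub> else 0)"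

locale artinian_ring = cring +
  assumes descending_chain_condition:
    "\<lbrakk>\<And>i::nat. ideal (J i) R; \<And>i. J (Suc i) \<subseteq> J i\<rbrakk> \<Longrightarrow> \<exists>n. \<forall>i\<ge>n. J i = J n"

locale equichar_artinian_local_ring = local_ring + artinian_ring +
  assumes equicharacteristic: "ring_characteristic R = ring_characteristic (residue_field R)"

section \<open>Length of a module\<close>

text \<open>The length is the supremum of the lengths \<open>n\<close> of strict chains
  \<open>N 0 \<subset> N 1 \<subset> \<dots> \<subset> N n\<close> of submodules.\<close>

definition module_length :: "('a, 'b) ring_scheme \<Rightarrow> ('a, 'c, 'd) module_scheme \<Rightarrow> enat" where
  "module_length R M =
    Sup {enat n | n. \<exists>N. (\<forall>i\<le>n. submodule (N i) R M) \<and> (\<forall>i<n. N i \<subset> N (Suc i))}"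

section \<open>Polynomial rings and their standard grading\<close>

text \<open>The coefficient ring is a type \<open>'a\<close>. A monomial is a finitely supported exponent vector, and
  the polynomial ring in \<open>b\<close> variables uses the variables with indices \<open>0, \<dots>, b - 1\<close>.\<close>

type_synonym 'a mpoly = "(nat \<Rightarrow>\<^sub>0 nat) \<Rightarrow>\<^sub>0 'a"

definition mpoly_ring :: "nat \<Rightarrow> 'a::comm_ring_1 mpoly ring" where
  "mpoly_ring b =
    ring_of_type_algebra\<lparr>carrier := {p. \<forall>m\<in>Poly_Mapping.keys p. Poly_Mapping.keys m \<subseteq> {..<b}}\<rparr>"

definition monom_degree :: "(nat \<Rightarrow>\<^sub>0 nat) \<Rightarrow> nat" where
  "monom_degree m = (\<Sum>i\<in>Poly_Mapping.keys m. Poly_Mapping.lookup m i)"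

definition homogeneous_component :: "nat \<Rightarrow> 'a::comm_ring_1 mpoly \<Rightarrow> 'a mpoly" where
  "homogeneous_component n p =
    (\<Sum>m | m \<in> Poly_Mapping.keys p \<and> monom_degree m = n.
      Poly_Mapping.single m (Poly_Mapping.lookup p m))"

definition homogeneous_polys :: "nat \<Rightarrow> nat \<Rightarrow> 'a::comm_ring_1 mpoly set" where
  "homogeneous_polys b n =
    {p \<in> carrier (mpoly_ring b). \<forall>m\<in>Poly_Mapping.keys p. monom_degree m = n}"

definition homogeneous_ideal :: "nat \<Rightarrow> 'a::comm_ring_1 mpoly set \<Rightarrow> bool" where
  "homogeneous_ideal b I \<longleftrightarrow>
    ideal I (mpoly_ring b) \<and> (\<forall>p\<in>I. \<forall>n. homogeneous_component n p \<in> I)"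

definition irrelevant_ideal :: "nat \<Rightarrow> 'a::comm_ring_1 mpoly set" where
  "irrelevant_ideal b = {p \<in> carrier (mpoly_ring b). homogeneous_component 0 p = 0}"

section \<open>Standard algebras\<close>

text \<open>A standard algebra is presented by its number \<open>b\<close> of variables and its ideal \<open>I\<close> of
  relations.\<close>

definition standard_presentation :: "nat \<Rightarrow> 'a::comm_ring_1 mpoly set \<Rightarrow> bool" where
  "standard_presentation b I \<longleftrightarrow>
    b \<ge> 1 \<and> homogeneous_ideal b I \<and> I \<subseteq> irrelevant_ideal b"

definition standard_algebra :: "nat \<Rightarrow> 'a::comm_ring_1 mpoly set \<Rightarrow> ('a, 'a mpoly set) module" where
  "standard_algebra b I =
    (let S = mpoly_ring b Quot I in
      \<lparr>carrier = carrier S, monoid.mult = monoid.mult S, one = \<one>\<^bsub>S\<^esub>, ring.zero = \<zero>\<^bsub>S\<^esub>, add = add S,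
       module.smult = (\<lambda>r x. (I +>\<^bsub>mpoly_ring b\<^esub> Poly_Mapping.single 0 r) \<otimes>\<^bsub>S\<^esub> x)\<rparr>)"

text \<open>The degree \<open>n\<close> component, as a module over the coefficient ring. It inherits the
  multiplication and the unit of the algebra only because the record type of modules extends that of
  rings; they play no role in the module structure.\<close>

definition graded_piece :: "nat \<Rightarrow> 'a::comm_ring_1 mpoly set \<Rightarrow> nat \<Rightarrow> ('a, 'a mpoly set) module" where
  "graded_piece b I n =
    (standard_algebra b I)\<lparr>carrier := (\<lambda>p. I +>\<^bsub>mpoly_ring b\<^esub> p) ` homogeneous_polys b n\<rparr>"

definition hilbert_function :: "nat \<Rightarrow> 'a::comm_ring_1 mpoly set \<Rightarrow> nat \<Rightarrow> enat" where
  "hilbert_function b I n = module_length (ring_of_type_algebra :: 'a ring) (graded_piece b I n)"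

text \<open>A polynomial over the rationals is determined by its values at all large \<open>n\<close>, so at most one
  polynomial satisfies this predicate.\<close>

definition is_hilbert_polynomial :: "nat \<Rightarrow> 'a::comm_ring_1 mpoly set \<Rightarrow> rat poly \<Rightarrow> bool" where
  "is_hilbert_polynomial b I h \<longleftrightarrow>
    (\<forall>\<^sub>F n in sequentially. \<exists>k. hilbert_function b I n = enat k \<and> poly h (of_nat n) = of_nat k)"

section \<open>Gotzmann developments\<close>

definition eventually_nat_polys :: "rat poly set" where
  "eventually_nat_polys = {P. \<forall>\<^sub>F n in sequentially. poly P (of_nat n) \<in> \<nat>}"

definition has_gotzmann_development :: "rat poly \<Rightarrow> bool" where
  "has_gotzmann_development P \<longleftrightarrow> P = 0 \<or>
    (\<exists>(s::nat) (c::nat \<Rightarrow> nat). s \<ge> 1 \<and> (\<forall>i\<in>{1..<s}. c (Suc i) \<le> c i) \<and>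
      (\<forall>\<^sub>F n in sequentially.
        poly P (of_nat n) = (\<Sum>i=1..s. (of_nat n + of_nat (c i) - (of_nat i - 1)) gchoose (c i))))"

end

theory Submission
  imports Defs "HOL-Library.Multiset"
begin

text \<open>Comparing leading coefficients expresses the length of a graded piece of \<open>R\<^sub>0[X]/I\<close> as the sum,
  over the monomials \<open>m\<close> of that degree, of the lengths \<open>a m\<close> of \<open>R\<^sub>0/c\<^sub>m\<close>, where \<open>c\<^sub>m\<close> is the ideal of
  leading coefficients of \<open>I\<close> at \<open>m\<close>. As \<open>a\<close> decreases under multiplication by variables, in large
  degrees the Hilbert function is a finite sum of counting functions of the order ideals
  \<open>{m. j \<le> a m}\<close>. Each order ideal has a finite Stanley decomposition into pieces \<open>u \<cdot> k[Z]\<close> such that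
  below a piece of degree \<open>a\<close> every degree \<open>t < a\<close> is the degree of a piece of at least the same
  dimension. This property survives finite sums, and Pascal's rule turns such a multiset of pieces
  into a Gotzmann development.
  Conversely, a development is realised by a lexicographic order ideal \<open>\<Omega>\<close>: the relations are the
  polynomials whose coefficients at monomials of \<open>\<Omega>\<close> lie in the maximal ideal.\<close>

section \<open>Order ideals of monomials\<close>

text \<open>A term binom(n + c - (i - 1), c) of a development counts the monomials of degree n in a
  piece of degree i - 1 with c + 1 variables. A development is thus a multiset with exactly one
  piece in each degree 0, ..., s - 1, of weakly decreasing dimension. Values \<open>a m\<close>
  above 1 force several order ideals to be added, and adding developments puts several pieces into
  one degree. So the exact shape is not carried through the induction: gap-freeness asks only for a
  witness in the same multiset, which a union inherits, and the shape is restored once, after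
  summation. That repair uses polynomial functions on the rationals, where Pascal's rule has no side
  condition on degrees. As the coefficients need not form a field, an ideal of leading coefficients
  at each monomial takes the place of an initial ideal. Lengths are suprema in \<open>enat\<close>,
  possibly infinite, so additivity is proved as two inequalities, each tested on chains of finite
  length.\<close>

type_synonym mono = "nat \<Rightarrow>\<^sub>0 nat"

abbreviation var :: "nat \<Rightarrow> mono" where
  "var y \<equiv> Poly_Mapping.single y 1"

definition monoms :: "nat set \<Rightarrow> mono set" where
  "monoms Y = {m. Poly_Mapping.keys m \<subseteq> Y}"

definition order_ideal :: "mono set \<Rightarrow> bool" where
  "order_ideal \<Omega> \<longleftrightarrow> (\<forall>u v. u + v \<in> \<Omega> \<longrightarrow> u \<in> \<Omega>)"

definition monom_count :: "mono set \<Rightarrow> nat \<Rightarrow> nat" where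
  "monom_count \<Omega> n = card {m \<in> \<Omega>. monom_degree m = n}"

text \<open>In terms of the monomial ideal complementary to an order ideal, this is the complement
  of its colon by the variable \<open>y\<close>.\<close>

definition colon :: "mono set \<Rightarrow> nat \<Rightarrow> mono set" where
  "colon \<Omega> y = {u. u + var y \<in> \<Omega>}"

lemma keys_plus_nat:
  fixes u v :: mono
  shows "Poly_Mapping.keys (u + v) = Poly_Mapping.keys u \<union> Poly_Mapping.keys v"
  by (auto simp: in_keys_iff lookup_add)

lemma monom_degree_add: "monom_degree (u + v) = monom_degree u + monom_degree v"
  unfolding monom_degree_def by (rule setsum_keys_plus_distrib) auto

lemma monom_degree_single [simp]: "monom_degree (Poly_Mapping.single i k) = k"
  by (simp add: monom_degree_def)

lemma monom_degree_zero [simp]: "monom_degree 0 = 0"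
  by (simp add: monom_degree_def)

lemma monom_degree_eq_0_iff [simp]: "monom_degree m = 0 \<longleftrightarrow> m = 0"
  by (auto simp: monom_degree_def in_keys_iff intro!: poly_mapping_eqI)

lemma lookup_le_monom_degree: "Poly_Mapping.lookup m i \<le> monom_degree m"
proof (cases "i \<in> Poly_Mapping.keys m")
  case True
  then show ?thesis
    unfolding monom_degree_def by (intro member_le_sum) auto
qed (simp add: in_keys_iff)

lemma minus_var_plus_var:
  fixes m :: mono
  assumes "y \<in> Poly_Mapping.keys m"
  shows "(m - var y) + var y = m"
  using assms
  by (intro poly_mapping_eqI) (auto simp: lookup_add lookup_minus lookup_single in_keys_iff when_def)

lemma plus_minus_of_lookup_le:
  fixes u v :: mono
  assumes "\<And>i. Poly_Mapping.lookup u i \<le> Poly_Mapping.lookup v i"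
  shows "u + (v - u) = v"
  using assms by (intro poly_mapping_eqI) (simp add: lookup_add lookup_minus)

lemma finite_monoms_degree:
  assumes "finite Y"
  shows "finite {m \<in> monoms Y. monom_degree m = n}"
proof -
  have "Poly_Mapping.lookup ` {m \<in> monoms Y. monom_degree m = n}
      \<subseteq> {f. \<forall>i. (i \<in> Y \<longrightarrow> f i \<in> {..n}) \<and> (i \<notin> Y \<longrightarrow> f i = 0)}"
    using lookup_le_monom_degree by (auto simp: monoms_def in_keys_iff)
  then have "finite (Poly_Mapping.lookup ` {m \<in> monoms Y. monom_degree m = n})"
    by (rule finite_subset) (rule finite_set_of_finite_funs, use assms in auto)
  then show ?thesis
    by (rule finite_imageD) (simp add: inj_on_def)
qed

lemma finite_degree_slice:
  "finite Y \<Longrightarrow> \<Omega> \<subseteq> monoms Y \<Longrightarrow> finite {m \<in> \<Omega>. monom_degree m = n}"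
  by (rule finite_subset[OF _ finite_monoms_degree[of Y n]]) auto

lemma order_ideal_monoms: "order_ideal (monoms Y)"
  by (auto simp: order_ideal_def monoms_def keys_plus_nat)

lemma order_ideal_Int: "order_ideal A \<Longrightarrow> order_ideal B \<Longrightarrow> order_ideal (A \<inter> B)"
  by (auto simp: order_ideal_def)

lemma order_ideal_colon: "order_ideal \<Omega> \<Longrightarrow> order_ideal (colon \<Omega> y)"
  unfolding order_ideal_def colon_def by (metis add.assoc add.commute mem_Collect_eq)

lemma colon_subset: "order_ideal \<Omega> \<Longrightarrow> colon \<Omega> y \<subseteq> \<Omega>"
  by (auto simp: order_ideal_def colon_def)

lemma colon_monoms: "y \<in> Y \<Longrightarrow> colon (monoms Y) y = monoms Y"
  by (auto simp: colon_def monoms_def keys_plus_nat)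

lemma zero_in_monoms: "0 \<in> monoms Y"
  by (simp add: monoms_def)

lemma zero_in_order_ideal: "order_ideal \<Omega> \<Longrightarrow> m \<in> \<Omega> \<Longrightarrow> 0 \<in> \<Omega>"
  unfolding order_ideal_def by (metis add_0)

text \<open>Monomials are sorted by divisibility by \<open>y\<close>; dividing by \<open>y\<close>
  identifies the divisible ones with the colon, one degree lower. This is the count behind the exact
  sequence of multiplication by \<open>y\<close>. The guard at \<open>n = 0\<close> is there because
  \<open>n - 1\<close> is truncated.\<close>

lemma monom_count_split:
  assumes Y: "finite Y" and sub: "\<Omega> \<subseteq> monoms (insert y Y)" and y: "y \<notin> Y"
  shows "monom_count \<Omega> n = monom_count (\<Omega> \<inter> monoms Y) n + (if n = 0 then 0 else monom_count (colon \<Omega> y) (n - 1))"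
proof -
  let ?A = "{m \<in> \<Omega> \<inter> monoms Y. monom_degree m = n}"
  let ?B = "{m \<in> \<Omega>. y \<in> Poly_Mapping.keys m \<and> monom_degree m = n}"
  have eq: "{m \<in> \<Omega>. monom_degree m = n} = ?A \<union> ?B" and disj: "?A \<inter> ?B = {}"
    using sub y by (auto simp: monoms_def)
  have fin: "finite {m \<in> \<Omega>. monom_degree m = n}"
    using Y sub by (intro finite_degree_slice[of "insert y Y"]) auto
  have "card ?B = (if n = 0 then 0 else monom_count (colon \<Omega> y) (n - 1))"
  proof (cases "n = 0")
    case False
    have "?B = (\<lambda>u. u + var y) ` {u \<in> colon \<Omega> y. monom_degree u = n - 1}"
    proof (intro equalityI subsetI)
      fix m assume m: "m \<in> ?B"
      then have m': "(m - var y) + var y = m"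
        by (intro minus_var_plus_var) simp
      have "monom_degree (m - var y) + 1 = n"
        using m arg_cong[OF m', of monom_degree] unfolding monom_degree_add by simp
      then show "m \<in> (\<lambda>u. u + var y) ` {u \<in> colon \<Omega> y. monom_degree u = n - 1}"
        using m m' by (intro image_eqI[of _ _ "m - var y"]) (auto simp: colon_def)
    qed (use False in \<open>auto simp: colon_def monom_degree_add keys_plus_nat\<close>)
    then show ?thesis
      using False by (simp add: monom_count_def card_image inj_on_def)
  qed auto
  then show ?thesis
    using fin disj unfolding monom_count_def eq by (subst card_Un_disjoint) auto
qed

text \<open>Splitting off a variable gives Pascal's rule. Truncated subtraction is also right for
  empty \<open>Y\<close>: \<open>1\<close> at \<open>n = 0\<close> and \<open>0\<close>
  elsewhere.\<close>

lemma monom_count_monoms: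
  assumes "finite Y"
  shows "monom_count (monoms Y) n = (n + card Y - 1) choose n"
  using assms
proof (induction Y arbitrary: n rule: finite_induct)
  case empty
  have "{m \<in> monoms {}. monom_degree m = n} = (if n = 0 then {0} else {})"
    by (auto simp: monoms_def)
  then show ?case by (simp add: monom_count_def)
next
  case (insert y Y)
  show ?case
  proof (induction n)
    case 0
    have "{m \<in> monoms (insert y Y). monom_degree m = 0} = {0}"
      by (auto simp: monoms_def)
    then show ?case by (simp add: monom_count_def)
  next
    case (Suc n)
    have "monoms (insert y Y) \<inter> monoms Y = monoms Y"
      by (auto simp: monoms_def)
    then have "monom_count (monoms (insert y Y)) (Suc n) = monom_count (monoms Y) (Suc n) + monom_count (monoms (insert y Y)) n"
      using monom_count_split[OF insert(1) order.refl insert(2), of "Suc n"] by (simp add: colon_monoms)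
    then show ?case
      using insert Suc by simp
  qed
qed

section \<open>Dickson's lemma and Stanley decompositions\<close>

lemma decseq_nat_eventually_const:
  fixes f :: "nat \<Rightarrow> nat"
  assumes "decseq f"
  shows "\<exists>N. \<forall>k\<ge>N. f k = f N"
proof -
  define N where "N = (ARG_MIN f k. True)"
  have "f N \<le> f k" for k
    using arg_min_nat_lemma[of "\<lambda>_. True" _ f] by (simp add: N_def)
  then show ?thesis
    using assms by (intro exI[of _ N] allI impI order_antisym) (auto dest: decseqD)
qed

text \<open>Dickson's lemma, one coordinate at a time: a sequence of naturals has a monotone
  subsequence, and a decreasing one is eventually constant, so a tail of it is increasing.\<close>

lemma dickson_subseq:
  fixes f :: "nat \<Rightarrow> nat \<Rightarrow> nat"
  assumes "finite Y"
  shows "\<exists>g :: nat \<Rightarrow> nat. strict_mono g \<and> (\<forall>i\<in>Y. incseq (\<lambda>k. f (g k) i))"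
  using assms
proof (induction Y rule: finite_induct)
  case empty
  show ?case by (rule exI[of _ id]) (simp add: strict_mono_def)
next
  case (insert y Y)
  then obtain g where g: "strict_mono g" "\<forall>i\<in>Y. incseq (\<lambda>k. f (g k) i)" by blast
  have "\<exists>h :: nat \<Rightarrow> nat. strict_mono h \<and> incseq (\<lambda>k. f (g (h k)) y)"
  proof -
    obtain h :: "nat \<Rightarrow> nat" where h: "strict_mono h" "monoseq (\<lambda>k. f (g (h k)) y)"
      using seq_monosub[of "\<lambda>k. f (g k) y"] by blast
    show ?thesis
    proof (cases "incseq (\<lambda>k. f (g (h k)) y)")
      case False
      then have "decseq (\<lambda>k. f (g (h k)) y)"
        using h(2) by (simp add: monoseq_iff)
      then obtain N where "\<forall>k\<ge>N. f (g (h k)) y = f (g (h N)) y"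
        using decseq_nat_eventually_const by blast
      then have "incseq (\<lambda>k. f (g (h (k + N))) y)"
        unfolding incseq_def by (metis le_add2 order_refl)
      moreover have "strict_mono (\<lambda>k. h (k + N))"
        using h(1) by (simp add: strict_mono_def)
      ultimately show ?thesis by blast
    qed (use h in blast)
  qed
  then obtain h where h: "strict_mono h" "incseq (\<lambda>k. f (g (h k)) y)" by blast
  have "incseq (\<lambda>k. f (g (h k)) i)" if "i \<in> insert y Y" for i
    using that h g(2) strict_mono_less_eq[OF h(1)] by (auto simp: incseq_def)
  moreover have "strict_mono (\<lambda>k. g (h k))"
    using g(1) h(1) by (simp add: strict_mono_def)
  ultimately show ?case
    by (intro exI[of _ "\<lambda>k. g (h k)"]) blast
qed

text \<open>Dual of the ascending chain condition for monomial ideals. In an infinite descent let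
  \<open>u i\<close> be lost at step \<open>i\<close>. By Dickson's lemma an earlier choice divides
  a later one; the later one survived that step, hence so did its divisor.\<close>

lemma wf_order_ideal_psubset:
  assumes "finite Y"
  shows "wf {(\<Omega>', \<Omega>). order_ideal \<Omega>' \<and> \<Omega>' \<subset> \<Omega> \<and> \<Omega> \<subseteq> monoms Y}"
proof (rule ccontr)
  assume "\<not> ?thesis"
  then obtain C where C: "\<And>i. order_ideal (C (Suc i))" "\<And>i. C (Suc i) \<subset> C i" "\<And>i. C i \<subseteq> monoms Y"
    unfolding wf_iff_no_infinite_down_chain not_not by clarify blast
  have "\<forall>i. \<exists>u. u \<in> C i - C (Suc i)"
    using C(2) by blast
  then obtain u where u: "\<And>i. u i \<in> C i - C (Suc i)"
    by metis
  obtain g :: "nat \<Rightarrow> nat" where g: "strict_mono g" "\<forall>i\<in>Y. incseq (\<lambda>k. Poly_Mapping.lookup (u (g k)) i)"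
    using dickson_subseq[OF assms, of "\<lambda>k. Poly_Mapping.lookup (u k)"] by blast
  let ?i = "g 0" and ?j = "g 1"
  have "Poly_Mapping.lookup (u ?i) i \<le> Poly_Mapping.lookup (u ?j) i" for i
  proof (cases "i \<in> Y")
    case True
    then show ?thesis using g(2) by (simp add: incseq_def)
  next
    case False
    then have "i \<notin> Poly_Mapping.keys (u ?i)"
      using u[of ?i] C(3)[of ?i] by (auto simp: monoms_def)
    then show ?thesis by (simp add: in_keys_iff)
  qed
  then have "u ?i + (u ?j - u ?i) = u ?j"
    by (rule plus_minus_of_lookup_le)
  moreover have "decseq C"
    using C(2) by (intro decseq_SucI) (rule psubset_imp_subset)
  moreover have "Suc ?i \<le> ?j"
    using g(1) by (simp add: strict_mono_def Suc_le_eq)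
  ultimately have "u ?i + (u ?j - u ?i) \<in> C (Suc ?i)"
    using u[of ?j] by (auto dest: decseqD)
  then have "u ?i \<in> C (Suc ?i)"
    using C(1)[of ?i] unfolding order_ideal_def by blast
  then show False using u[of ?i] by simp
qed

text \<open>A piece \<open>(a, z)\<close> stands for \<open>u \<cdot> k[Z]\<close> with \<open>u\<close> a monomial of degree \<open>a\<close> and \<open>Z\<close> a set of \<open>z\<close> variables.\<close>

definition pieces_count :: "(nat \<times> nat) multiset \<Rightarrow> nat \<Rightarrow> nat" where
  "pieces_count A n = (\<Sum>(a, z)\<in>#A. if a \<le> n then (n - a + z - 1) choose (n - a) else 0)"

definition gap_free :: "(nat \<times> nat) multiset \<Rightarrow> bool" where
  "gap_free A \<longleftrightarrow> (\<forall>(a, z)\<in>#A. \<forall>t<a. \<exists>z'\<ge>z. (t, z') \<in># A)"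

lemma gap_freeD:
  "gap_free A \<Longrightarrow> (a, z) \<in># A \<Longrightarrow> t < a \<Longrightarrow> \<exists>z'\<ge>z. (t, z') \<in># A"
  by (auto simp: gap_free_def)

lemma pieces_count_add: "pieces_count (A + B) n = pieces_count A n + pieces_count B n"
  by (simp add: pieces_count_def)

lemma pieces_count_shift:
  "pieces_count (image_mset (\<lambda>(a, z). (Suc a, z)) A) n = (if n = 0 then 0 else pieces_count A (n - 1))"
  by (cases n) (simp_all add: pieces_count_def case_prod_unfold multiset.map_comp comp_def cong: if_cong)

text \<open>The induction splits off a variable \<open>y\<close> outside a maximal \<open>Z\<close> with \<open>k[Z] \<subseteq> \<Omega>\<close>; maximality forces
  \<open>colon \<Omega> y \<subset> \<Omega>\<close>, and the part of \<open>\<Omega>\<close> without \<open>y\<close> still contains \<open>k[Z]\<close>.\<close>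

lemma order_ideal_decomposition:
  assumes "finite Y" "order_ideal \<Omega>" "\<Omega> \<subseteq> monoms Y"
  shows "\<exists>A. (\<forall>n. monom_count \<Omega> n = pieces_count A n) \<and> gap_free A \<and>
    (\<forall>(a, z)\<in>#A. \<exists>Z\<subseteq>Y. card Z = z \<and> monoms Z \<subseteq> \<Omega>) \<and>
    (\<forall>Z\<subseteq>Y. monoms Z \<subseteq> \<Omega> \<longrightarrow> (\<exists>z'\<ge>card Z. (0, z') \<in># A))"
  using assms
proof (induction Y arbitrary: \<Omega> rule: finite_psubset_induct)
  case (psubset Y)
  note IHY = psubset.IH and finY = psubset.hyps
  show ?case
    using psubset.prems
  \<comment> \<open>Removing a variable is left to the outer induction; passing to the colon keeps
    \<open>Y\<close> and uses this inner one.\<close>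
  proof (induction \<Omega> rule: wf_induct_rule[OF wf_order_ideal_psubset[OF finY]])
    case (1 \<Omega>)
    note IH = 1(1) and oi = 1(2) and sub = 1(3)
    show ?case
    proof (cases "\<Omega> = {}")
      case True
      then show ?thesis
        using zero_in_monoms by (intro exI[of _ "{#}"]) (auto simp: monom_count_def pieces_count_def gap_free_def)
    next
      case False
      let ?\<F> = "{Z. Z \<subseteq> Y \<and> monoms Z \<subseteq> \<Omega>}"
      have "monoms {} \<subseteq> \<Omega>"
        using False zero_in_order_ideal[OF oi] by (auto simp: monoms_def)
      then have "?\<F> \<noteq> {}" by blast
      moreover have fin\<F>: "finite ?\<F>"
        using finY by simp
      ultimately have "Max (card ` ?\<F>) \<in> card ` ?\<F>"
        by (intro Max_in) auto
      \<comment> \<open>Maximal cardinality is chosen, not just maximality under inclusion, because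
        it has to bound the dimension of every piece.\<close>
      then obtain Z where Z: "Z \<in> ?\<F>" "card Z = Max (card ` ?\<F>)"
        by (metis (no_types, lifting) imageE)
      have Zmax: "card Z' \<le> card Z" if "Z' \<in> ?\<F>" for Z'
        unfolding Z(2) using fin\<F> that by (intro Max_ge) auto
      show ?thesis
      proof (cases "Z = Y")
        case True
        then have eq: "\<Omega> = monoms Y" using Z sub by auto
        have "monom_count \<Omega> n = pieces_count {#(0, card Y)#} n" for n
          by (simp add: eq monom_count_monoms finY pieces_count_def)
        then show ?thesis
          by (intro exI[of _ "{#(0, card Y)#}"])
            (use eq finY in \<open>auto simp: gap_free_def intro: card_mono\<close>)
      next
        case False
        then obtain y where y: "y \<in> Y" "y \<notin> Z" using Z by auto
        let ?Y' = "Y - {y}" and ?\<Omega>1 = "\<Omega> \<inter> monoms (Y - {y})" and ?\<Omega>2 = "colon \<Omega> y"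
        have "?\<Omega>2 \<noteq> \<Omega>"
        proof
          assume eq: "?\<Omega>2 = \<Omega>"
          \<comment> \<open>Equality with the colon means closure under multiplication by
            \<open>y\<close>, so any power of \<open>y\<close> can be put back onto a monomial in
            \<open>monoms Z\<close>.\<close>
          have "m \<in> monoms (insert y Z) \<Longrightarrow> m \<in> \<Omega>" for m
          proof (induction "Poly_Mapping.lookup m y" arbitrary: m)
            case 0
            then have "m \<in> monoms Z" by (auto simp: monoms_def in_keys_iff)
            then show ?case using Z by auto
          next
            case (Suc k)
            then have "y \<in> Poly_Mapping.keys m" by (simp add: in_keys_iff)
            then have m: "(m - var y) + var y = m" by (rule minus_var_plus_var)
            have "Poly_Mapping.lookup (m - var y) y = k"
              using Suc(2) by (simp add: lookup_minus)
            moreover have "m - var y \<in> monoms (insert y Z)"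
              using Suc(3) m order_ideal_monoms unfolding order_ideal_def by metis
            ultimately have "m - var y \<in> \<Omega>" using Suc(1) by blast
            then have "m - var y \<in> ?\<Omega>2" using eq by simp
            then show ?case using m unfolding colon_def by simp
          qed
          then have "insert y Z \<in> ?\<F>" using y Z by auto
          moreover have "card (insert y Z) = Suc (card Z)"
            using Z y finite_subset[OF _ finY] by simp
          ultimately show False using Zmax[of "insert y Z"] by linarith
        qed
        then have psub: "?\<Omega>2 \<subset> \<Omega>" using colon_subset[OF oi] by auto
        have oi1: "order_ideal ?\<Omega>1" and oi2: "order_ideal ?\<Omega>2"
          using oi by (auto intro: order_ideal_Int order_ideal_monoms order_ideal_colon)
        have rel: "(?\<Omega>2, \<Omega>) \<in> {(\<Omega>', \<Omega>). order_ideal \<Omega>' \<and> \<Omega>' \<subset> \<Omega> \<and> \<Omega> \<subseteq> monoms Y}"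
          and sub2: "?\<Omega>2 \<subseteq> monoms Y"
          using oi2 psub sub by auto
        obtain A2 where A2: "\<And>n. monom_count ?\<Omega>2 n = pieces_count A2 n" "gap_free A2"
          "\<forall>(a, z)\<in>#A2. \<exists>Z\<subseteq>Y. card Z = z \<and> monoms Z \<subseteq> ?\<Omega>2"
          using IH[OF rel oi2 sub2] by blast
        obtain A1 where A1: "\<And>n. monom_count ?\<Omega>1 n = pieces_count A1 n" "gap_free A1"
          "\<forall>(a, z)\<in>#A1. \<exists>Z\<subseteq>?Y'. card Z = z \<and> monoms Z \<subseteq> ?\<Omega>1"
          "\<forall>Z\<subseteq>?Y'. monoms Z \<subseteq> ?\<Omega>1 \<longrightarrow> (\<exists>z'\<ge>card Z. (0, z') \<in># A1)"
          using IHY[of ?Y' ?\<Omega>1] oi1 y(1) by blast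
        let ?S = "image_mset (\<lambda>(a, z). (Suc a, z)) A2"
        have Z': "Z \<subseteq> ?Y'" "monoms Z \<subseteq> ?\<Omega>1" using Z y by (auto simp: monoms_def)
        \<comment> \<open>The piece \<open>(0, z0)\<close> dominates every piece of
          \<open>A2\<close>, since each of those carries some \<open>Z'\<close> with
          \<open>monoms Z' \<subseteq> \<Omega>\<close>. The last two conjuncts of the claim are
          carried along for this comparison.\<close>
        obtain z0 where z0: "z0 \<ge> card Z" "(0, z0) \<in># A1"
          using A1(4)[rule_format, OF Z'] by blast
        have z0_ge: "z \<le> z0" if "(a, z) \<in># A2" for a z
        proof -
          from bspec[OF A2(3) that] obtain Z' where "Z' \<subseteq> Y" "card Z' = z" "monoms Z' \<subseteq> ?\<Omega>2"
            by auto
          moreover from this have "monoms Z' \<subseteq> \<Omega>" using psub by blast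
          ultimately show ?thesis using Zmax[of Z'] z0(1) by simp
        qed
        have "monom_count \<Omega> n = pieces_count (A1 + ?S) n" for n
          using monom_count_split[of ?Y' \<Omega> y n] finY sub y(1) A1(1) A2(1)
          by (simp add: pieces_count_add pieces_count_shift insert_absorb)
        moreover have "gap_free (A1 + ?S)"
          unfolding gap_free_def
        proof (intro ballI, clarify)
          fix a z t assume az: "(a, z) \<in># A1 + ?S" and t: "t < a"
          from az consider "(a, z) \<in># A1" | a' where "a = Suc a'" "(a', z) \<in># A2" by auto
          then show "\<exists>z'\<ge>z. (t, z') \<in># A1 + ?S"
          proof cases
            case 1
            then show ?thesis using gap_freeD[OF A1(2) _ t] by auto
          next
            case 2
            show ?thesis
            \<comment> \<open>The shift by one opens a gap at degree \<open>0\<close> only, and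
              \<open>(0, z0)\<close> fills it.\<close>
            proof (cases t)
              case 0
              then show ?thesis using z0 z0_ge[OF 2(2)] by auto
            next
              case (Suc t')
              then obtain z' where z': "z' \<ge> z" "(t', z') \<in># A2"
                using gap_freeD[OF A2(2) 2(2)] 2(1) t by auto
              have "(t, z') \<in># ?S"
                using z'(2) Suc by (auto intro!: image_eqI[of _ _ "(t', z')"])
              then show ?thesis using z'(1) by auto
            qed
          qed
        qed
        moreover have "\<exists>Z\<subseteq>Y. card Z = z \<and> monoms Z \<subseteq> \<Omega>" if az: "(a, z) \<in># A1 + ?S" for a z
        proof -
          from az consider "(a, z) \<in># A1" | a' where "(a', z) \<in># A2" by auto
          then show ?thesis
          proof cases
            case 1
            from bspec[OF A1(3) this] show ?thesis by auto
          next
            case 2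
            from bspec[OF A2(3) 2] obtain Z' where Z': "Z' \<subseteq> Y" "card Z' = z" "monoms Z' \<subseteq> ?\<Omega>2"
              by auto
            then have "monoms Z' \<subseteq> \<Omega>" using psub by blast
            then show ?thesis using Z' by (intro exI[of _ Z']) simp
          qed
        qed
        moreover have "\<exists>z'\<ge>card Z'. (0, z') \<in># A1 + ?S" if "Z' \<subseteq> Y" "monoms Z' \<subseteq> \<Omega>" for Z'
          using Zmax[of Z'] z0 that by (intro exI[of _ z0]) simp
        ultimately show ?thesis
          by (intro exI[of _ "A1 + ?S"] conjI allI impI ballI) (simp_all only: split_paired_all prod.case)
      qed
    qed
  qed
qed

section \<open>From piece counts to Gotzmann developments\<close>

text \<open>The second component is now the degree of the counting polynomial, one less than the
  number of variables. With \<open>gchoose\<close> this is a polynomial function of every rational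
  \<open>x\<close>, also below the shift.\<close>

definition piece_val :: "nat \<times> nat \<Rightarrow> rat \<Rightarrow> rat" where
  "piece_val p x = (x - of_nat (fst p) + of_nat (snd p)) gchoose (snd p)"

text \<open>Iterated Pascal's rule. Fixing a variable of a piece, its multiples form a piece of
  equal dimension and next higher shift; the rest is a piece of the old shift, one dimension
  lower.\<close>

lemma piece_val_raise:
  assumes "a \<le> s"
  shows "piece_val (a, Suc d) x = piece_val (s, Suc d) x + (\<Sum>t\<in>{a..<s}. piece_val (t, d) x)"
  using assms
proof (induction s rule: dec_induct)
  case (step s)
  have "piece_val (s, Suc d) x = piece_val (Suc s, Suc d) x + piece_val (s, d) x"
    using gbinomial_Suc_Suc[of "x - of_nat s + of_nat d" d]
    by (simp add: piece_val_def algebra_simps)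
  then show ?case
    using step by simp
qed simp

text \<open>Among the pieces of maximal dimension, take one of minimal shift \<open>a\<close>; the invariant gives
  \<open>a \<le> s\<close>. Raising its shift to \<open>s\<close> makes it the next summand of the development and releases
  pieces of lower dimension.\<close>

lemma pieces_normal_form:
  assumes "\<And>a d t. (a, d) \<in># A \<Longrightarrow> t < a \<Longrightarrow> t < s \<or> (\<exists>d'\<ge>d. (t, d') \<in># A)"
  shows "\<exists>cs. sorted_wrt (\<ge>) cs \<and> (\<forall>c\<in>set cs. \<exists>p\<in>#A. c \<le> snd p) \<and>
    (\<forall>x. (\<Sum>p\<in>#A. piece_val p x) = (\<Sum>i<length cs. piece_val (s + i, cs ! i) x))"
  using assms
\<comment> \<open>Each round replaces one dimension \<open>d\<close> by finitely many copies of
  \<open>d - 1\<close> (none if \<open>d = 0\<close>), a descent in the multiset order; shifts are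
  ignored.\<close>
proof (induction A arbitrary: s rule: wf_induct_rule[OF wf_inv_image[OF wf_mult[OF wf_less_than], of "image_mset snd"]])
  case (1 A)
  note IH = 1(1) and inv = 1(2)
  show ?case
  proof (cases "A = {#}")
    case True
    then show ?thesis by (intro exI[of _ "[]"]) simp
  next
    case False
    define d where "d = Max (snd ` set_mset A)"
    have d_max: "snd p \<le> d" if "p \<in># A" for p
      unfolding d_def using that by (intro Max_ge) auto
    have "d \<in> snd ` set_mset A"
      unfolding d_def using False by (intro Max_in) auto
    then have ex: "\<exists>a. (a, d) \<in># A" by force
    define a where "a = (LEAST a. (a, d) \<in># A)"
    have a: "(a, d) \<in># A"
      unfolding a_def using ex by (rule LeastI_ex)
    have a_min: "a \<le> a'" if "(a', d) \<in># A" for a'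
      unfolding a_def using that by (rule Least_le)
    have "a \<le> s"
    proof (rule ccontr)
      assume "\<not> a \<le> s"
      then obtain d' where "d' \<ge> d" "(s, d') \<in># A"
        using inv[OF a, of s] by auto
      then have "(s, d) \<in># A"
        using d_max[of "(s, d')"] by simp
      then show False using a_min \<open>\<not> a \<le> s\<close> by blast
    qed
    obtain A0 where A0: "A = add_mset (a, d) A0"
      using a by (meson mset_add)
    \<comment> \<open>At \<open>d = 0\<close> the value is constantly \<open>1\<close> whatever the
      shift, so raising releases nothing.\<close>
    define R where "R = (if d = 0 then {#} else image_mset (\<lambda>t. (t, d - 1)) (mset_set {a..<s}))"
    have R_mem: "p \<in># R \<Longrightarrow> a \<le> fst p \<and> fst p < s \<and> snd p < d" for p
      by (auto simp: R_def split: if_splits)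
    have "(image_mset snd (A0 + R), image_mset snd A) \<in> mult less_than"
      using one_step_implies_mult[of "{#d#}" "image_mset snd R" less_than "image_mset snd A0"] R_mem
      by (auto simp: A0)
    then have rel: "(A0 + R, A) \<in> inv_image (mult less_than) (image_mset snd)"
      by simp
    \<comment> \<open>Shifts below \<open>Suc s\<close> already carry summands of the development,
      so gaps there are harmless.\<close>
    have inv': "t < Suc s \<or> (\<exists>d''\<ge>d'. (t, d'') \<in># A0 + R)" if p: "(a', d') \<in># A0 + R" and t: "t < a'" for a' d' t
    proof (cases "(a', d') \<in># R")
      case True
      then show ?thesis using R_mem[OF True] t by simp
    next
      case False
      then have "(a', d') \<in># A" using p A0 by simp
      then consider "t < s" | d'' where "d'' \<ge> d'" "(t, d'') \<in># A"
        using inv t by blast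
      then show ?thesis
      proof cases
        case 2
        \<comment> \<open>If the witness was the removed piece \<open>(a, d)\<close>, then
          \<open>t = a \<le> s\<close> and the first alternative holds.\<close>
        then show ?thesis
          using \<open>a \<le> s\<close> A0 by (cases "(t, d'') = (a, d)") auto
      qed simp
    qed
    have "\<exists>cs. sorted_wrt (\<ge>) cs \<and> (\<forall>c\<in>set cs. \<exists>p\<in>#A0 + R. c \<le> snd p) \<and>
      (\<forall>x. (\<Sum>p\<in>#A0 + R. piece_val p x) = (\<Sum>i<length cs. piece_val (Suc s + i, cs ! i) x))"
      by (rule IH[OF rel]) (rule inv')
    then obtain cs where cs: "sorted_wrt (\<ge>) cs" "\<forall>c\<in>set cs. \<exists>p\<in>#A0 + R. c \<le> snd p"
      "\<And>x. (\<Sum>p\<in>#A0 + R. piece_val p x) = (\<Sum>i<length cs. piece_val (Suc s + i, cs ! i) x)"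
      by blast
    have le_d: "c \<le> d" if "c \<in> set cs" for c
    proof -
      from bspec[OF cs(2) that] obtain p where "p \<in># A0 + R" "c \<le> snd p" by blast
      then show ?thesis using d_max[of p] R_mem[of p] A0 by auto
    qed
    have "piece_val (a, d) x = piece_val (s, d) x + (\<Sum>p\<in>#R. piece_val p x)" for x
    proof (cases d)
      case 0
      then show ?thesis by (simp add: R_def piece_val_def)
    next
      case (Suc e)
      then show ?thesis
        using piece_val_raise[OF \<open>a \<le> s\<close>, of e x]
        by (simp add: R_def multiset.map_comp comp_def sum_unfold_sum_mset)
    qed
    then have "(\<Sum>p\<in>#A. piece_val p x) = piece_val (s, d) x + (\<Sum>p\<in>#A0 + R. piece_val p x)" for x
      by (simp add: A0)
    then have "(\<Sum>p\<in>#A. piece_val p x) = (\<Sum>i<length (d # cs). piece_val (s + i, (d # cs) ! i) x)" for x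
      unfolding cs(3) by (simp add: sum.lessThan_Suc_shift del: sum.lessThan_Suc)
    moreover have "sorted_wrt (\<ge>) (d # cs)"
      using cs(1) le_d by simp
    moreover have "\<forall>c\<in>set (d # cs). \<exists>p\<in>#A. c \<le> snd p"
      using a le_d by (auto intro!: bexI[of _ "(a, d)"])
    ultimately show ?thesis by blast
  qed
qed

text \<open>A piece without variables is a single monomial, invisible in large degrees. The
  decrement passes from the number of variables to the degree of the counting polynomial.\<close>

definition proper_pieces :: "(nat \<times> nat) multiset \<Rightarrow> (nat \<times> nat) multiset" where
  "proper_pieces A = {#(a, z - 1). (a, z) \<in># filter_mset (\<lambda>(a, z). z > 0) A#}"

text \<open>Strictness of \<open>a < n\<close> matters: at \<open>n = a\<close> a piece without
  variables still counts its one monomial.\<close>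

lemma piece_val_of_nat:
  assumes "a < n"
  shows "of_nat ((n - a + z - 1) choose (n - a)) = (if z > 0 then piece_val (a, z - 1) (of_nat n) else 0)"
proof (cases z)
  case 0
  then show ?thesis using assms by simp
next
  case (Suc d)
  have "(n - a + d) choose (n - a) = (n - a + d) choose d"
    using binomial_symmetric[of d "n - a + d"] by simp
  moreover have "of_nat (n - a + d) = (of_nat n - of_nat a + of_nat d :: rat)"
    using assms by (simp add: of_nat_diff)
  ultimately show ?thesis
    using Suc by (simp add: piece_val_def binomial_gbinomial algebra_simps)
qed

lemma pieces_count_eventually:
  "\<forall>\<^sub>F n in sequentially. of_nat (pieces_count A n) = (\<Sum>p\<in>#proper_pieces A. piece_val p (of_nat n))"
proof (induction A)
  case empty
  show ?case by (simp add: pieces_count_def proper_pieces_def)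
next
  case (add p A)
  obtain a z where p: "p = (a, z)" by force
  show ?case
    using add.IH eventually_gt_at_top[of a]
  proof eventually_elim
    case (elim n)
    then show ?case
      using piece_val_of_nat[of a n z] by (simp add: p pieces_count_def proper_pieces_def)
  qed
qed

lemma gotzmann_of_pieces:
  fixes P :: "rat poly"
  assumes ev: "\<forall>\<^sub>F n in sequentially. poly P (of_nat n) = of_nat (pieces_count A n)"
    and gap: "gap_free A"
  shows "has_gotzmann_development P"
proof -
  \<comment> \<open>With no summand placed yet (\<open>s = 0\<close>), the invariant of
    \<open>pieces_normal_form\<close> is gap-freeness itself.\<close>
  have "t < 0 \<or> (\<exists>d'\<ge>d. (t, d') \<in># proper_pieces A)"
    if p: "(a, d) \<in># proper_pieces A" and t: "t < a" for a d t
  proof -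
    from p obtain z where z: "(a, z) \<in># A" "z > 0" "d = z - 1"
      by (auto simp: proper_pieces_def)
    obtain z' where "z' \<ge> z" "(t, z') \<in># A"
      using gap_freeD[OF gap z(1) t] by blast
    then have "(t, z' - 1) \<in># proper_pieces A" "z' - 1 \<ge> d"
      using z by (auto simp: proper_pieces_def intro!: image_eqI[of _ _ "(t, z')"])
    then show ?thesis by blast
  qed
  then obtain cs where cs: "sorted_wrt (\<ge>) cs"
    "\<And>x. (\<Sum>p\<in>#proper_pieces A. piece_val p x) = (\<Sum>i<length cs. piece_val (0 + i, cs ! i) x)"
    using pieces_normal_form[of "proper_pieces A" 0] by blast
  have ev': "\<forall>\<^sub>F n in sequentially. poly P (of_nat n) = (\<Sum>i<length cs. piece_val (i, cs ! i) (of_nat n))"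
    using ev pieces_count_eventually[of A] by eventually_elim (simp add: cs(2))
  show ?thesis
  proof (cases "cs = []")
    case True
    then obtain N where N: "\<And>n. n \<ge> N \<Longrightarrow> poly P (of_nat n) = 0"
      using ev' by (auto simp: eventually_sequentially)
    have "P = 0"
    proof (rule ccontr)
      assume "P \<noteq> 0"
      then have "finite {x. poly P x = 0}" by (rule poly_roots_finite)
      moreover have "of_nat ` {N..} \<subseteq> {x. poly P x = 0}" using N by auto
      ultimately have "finite ((of_nat :: nat \<Rightarrow> rat) ` {N..})" by (rule finite_subset[rotated])
      then have "finite {N..}" by (rule finite_imageD) (simp add: inj_on_def)
      then show False by (simp add: infinite_Ici)
    qed
    then show ?thesis by (simp add: has_gotzmann_development_def)
  next
    case False
    define c where "c i = cs ! (i - 1)" for i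
    have "\<forall>i\<in>{1..<length cs}. c (Suc i) \<le> c i"
      using sorted_wrt_nth_less[OF cs(1)] by (auto simp: c_def)
    moreover have "(\<Sum>i<length cs. piece_val (i, cs ! i) x) =
        (\<Sum>i=1..length cs. (x + of_nat (c i) - (of_nat i - 1)) gchoose (c i))" for x
    proof -
      have "(\<Sum>i=1..length cs. (x + of_nat (c i) - (of_nat i - 1)) gchoose (c i)) =
          (\<Sum>i<length cs. (x + of_nat (c (Suc i)) - (of_nat (Suc i) - 1)) gchoose (c (Suc i)))"
        by (rule sum.reindex_bij_witness[of _ Suc "\<lambda>i. i - 1"]) auto
      then show ?thesis
        by (simp add: c_def piece_val_def algebra_simps)
    qed
    ultimately show ?thesis
      using False ev' unfolding has_gotzmann_development_def
      by (intro disjI2 exI[of _ "length cs"] exI[of _ c]) (simp add: Suc_le_eq)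
  qed
qed

section \<open>Order ideals with a prescribed Gotzmann development\<close>

text \<open>Unfolding yields one piece for each list entry: the entry \<open>c\<close> at position
  \<open>i\<close>, counted from 0, contributes \<open>c + 1\<close> variables, multiplied by one
  variable \<open>Suc c'\<close> for each earlier entry \<open>c'\<close>. Its degree is therefore
  \<open>i\<close>, as in the development.\<close>

fun lex_set :: "nat list \<Rightarrow> mono set" where
  "lex_set [] = {}"
| "lex_set (c # cs) = monoms {..c} \<union> (\<lambda>u. u + var (Suc c)) ` lex_set cs"

lemma monoms_mono: "Y \<subseteq> Z \<Longrightarrow> monoms Y \<subseteq> monoms Z"
  by (auto simp: monoms_def)

lemma lex_set_subset_monoms:
  assumes "\<And>x. x \<in> set cs \<Longrightarrow> x \<le> c"
  shows "lex_set cs \<subseteq> monoms {..Suc c}"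
  using assms
proof (induction cs)
  case (Cons d cs)
  have "d \<le> c" using Cons.prems by simp
  moreover have "lex_set cs \<subseteq> monoms {..Suc c}"
    using Cons by simp
  ultimately show ?case
    by (fastforce simp: monoms_def keys_plus_nat)
qed simp

text \<open>If the next entry is smaller than \<open>c\<close>, the whole tail already lies in
  \<open>monoms {..c}\<close>. If it equals \<open>c\<close>, both sets are built with the same
  variables and the induction hypothesis applies.\<close>

lemma lex_set_tail_subset:
  assumes "sorted_wrt (\<ge>) (c # cs)"
  shows "lex_set cs \<subseteq> lex_set (c # cs)"
  using assms
proof (induction cs)
  case (Cons d cs)
  show ?case
  proof (cases "d = c")
    case True
    have "lex_set cs \<subseteq> lex_set (d # cs)"
      using Cons True by simp
    then show ?thesis using True by auto
  next
    case False
    then have "Suc d \<le> c" using Cons.prems by simp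
    have "lex_set (d # cs) \<subseteq> monoms {..Suc d}"
      by (rule lex_set_subset_monoms) (use Cons.prems in auto)
    also have "\<dots> \<subseteq> monoms {..c}"
      using \<open>Suc d \<le> c\<close> by (intro monoms_mono) simp
    finally show ?thesis by auto
  qed
qed simp

text \<open>For a factor \<open>u\<close> of \<open>w + var (Suc c)\<close>, either \<open>u\<close>
  contains the new variable, which then cancels, or \<open>u\<close> divides \<open>w\<close>. The
  second case needs the inclusion of the tail.\<close>

lemma order_ideal_lex_set:
  assumes "sorted_wrt (\<ge>) cs"
  shows "order_ideal (lex_set cs)"
  using assms
proof (induction cs)
  case Nil
  show ?case by (simp add: order_ideal_def)
next
  case (Cons c cs)
  then have IH: "order_ideal (lex_set cs)" by simp
  show ?case
    unfolding order_ideal_def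
  proof (intro allI impI)
    fix u v assume "u + v \<in> lex_set (c # cs)"
    then consider "u + v \<in> monoms {..c}" | w where "w \<in> lex_set cs" "u + v = w + var (Suc c)"
      by auto
    then show "u \<in> lex_set (c # cs)"
    proof cases
      case 1
      then show ?thesis by (auto simp: monoms_def keys_plus_nat)
    next
      case 2
      have "Suc c \<in> Poly_Mapping.keys u \<union> Poly_Mapping.keys v"
        unfolding keys_plus_nat[symmetric] 2(2) by (simp add: keys_plus_nat)
      then show ?thesis
      proof
        assume "Suc c \<in> Poly_Mapping.keys u"
        then have u: "(u - var (Suc c)) + var (Suc c) = u" by (rule minus_var_plus_var)
        have "((u - var (Suc c)) + v) + var (Suc c) = w + var (Suc c)"
          using 2(2) u by (metis add.assoc add.commute)
        then have "(u - var (Suc c)) + v = w" by simp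
        then have "u - var (Suc c) \<in> lex_set cs"
          using IH 2(1) unfolding order_ideal_def by blast
        then have "u \<in> (\<lambda>u. u + var (Suc c)) ` lex_set cs"
          by (intro image_eqI[of _ _ "u - var (Suc c)"]) (rule u[symmetric])
        then show ?thesis by simp
      next
        assume "Suc c \<in> Poly_Mapping.keys v"
        then have v: "(v - var (Suc c)) + var (Suc c) = v" by (rule minus_var_plus_var)
        have "(u + (v - var (Suc c))) + var (Suc c) = w + var (Suc c)"
          using 2(2) v by (metis add.assoc)
        then have "u + (v - var (Suc c)) = w" by simp
        then have "u \<in> lex_set cs"
          using IH 2(1) unfolding order_ideal_def by blast
        then show ?thesis using lex_set_tail_subset[OF Cons.prems] by blast
      qed
    qed
  qed
qed

text \<open>Split at the variable \<open>Suc c\<close>: what avoids it is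
  \<open>monoms {..c}\<close>, and the colon by it is \<open>lex_set cs\<close>.\<close>

lemma monom_count_lex_set_Cons:
  assumes "sorted_wrt (\<ge>) (c # cs)"
  shows "monom_count (lex_set (c # cs)) n =
    ((n + c) choose c) + (if n = 0 then 0 else monom_count (lex_set cs) (n - 1))"
proof -
  let ?\<Omega> = "lex_set (c # cs)"
  have "?\<Omega> \<subseteq> monoms {..Suc c}"
    by (rule lex_set_subset_monoms) (use assms in auto)
  then have sub: "?\<Omega> \<subseteq> monoms (insert (Suc c) {..c})"
    by (simp add: atMost_Suc)
  have "?\<Omega> \<inter> monoms {..c} = monoms {..c}"
    by auto
  moreover have "colon ?\<Omega> (Suc c) = lex_set cs"
    by (auto simp: colon_def monoms_def keys_plus_nat)
  moreover have "monom_count (monoms {..c}) n = (n + c) choose c"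
    using binomial_symmetric[of c "n + c"] by (simp add: monom_count_monoms)
  ultimately show ?thesis
    using monom_count_split[OF _ sub, of n] by simp
qed

text \<open>The bound on \<open>n\<close> keeps every shift below \<open>n\<close>. Below its shift
  a piece counts nothing, whereas \<open>piece_val\<close> need not vanish; for dimension entry
  \<open>0\<close> it is \<open>1\<close>.\<close>

lemma monom_count_lex_set:
  assumes "sorted_wrt (\<ge>) cs" "length cs \<le> n"
  shows "of_nat (monom_count (lex_set cs) n) = (\<Sum>i<length cs. piece_val (i, cs ! i) (of_nat n))"
  using assms
proof (induction cs arbitrary: n)
  case Nil
  show ?case by (simp add: monom_count_def)
next
  case (Cons c cs)
  then obtain m where n: "n = Suc m" "length cs \<le> m" by (cases n) auto
  have "of_nat (monom_count (lex_set (c # cs)) n) = of_nat ((n + c) choose c) + (of_nat (monom_count (lex_set cs) m) :: rat)"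
    using monom_count_lex_set_Cons[OF Cons.prems(1), of n] n by simp
  also have "of_nat ((n + c) choose c) = piece_val (0, c) (of_nat n)"
    by (simp add: piece_val_def binomial_gbinomial)
  also have "of_nat (monom_count (lex_set cs) m) = (\<Sum>i<length cs. piece_val (i, cs ! i) (of_nat m))"
    using Cons n by simp
  also have "\<dots> = (\<Sum>i<length cs. piece_val (Suc i, (c # cs) ! Suc i) (of_nat n))"
    by (simp add: n piece_val_def)
  finally show ?case
    by (simp add: sum.lessThan_Suc_shift del: sum.lessThan_Suc)
qed

lemma gotzmann_development_list:
  assumes "has_gotzmann_development P"
  obtains cs where "sorted_wrt (\<ge>) cs"
    "\<forall>\<^sub>F n in sequentially. poly P (of_nat n) = (\<Sum>i<length cs. piece_val (i, cs ! i) (of_nat n))"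
proof (cases "P = 0")
  case True
  show thesis by (rule that[of "[]"]) (simp_all add: True)
next
  case False
  then obtain s c where sc: "\<forall>i\<in>{1..<s}. c (Suc i) \<le> c i"
    "\<forall>\<^sub>F n in sequentially. poly P (of_nat n) =
      (\<Sum>i=1..s. (of_nat n + of_nat (c i) - (of_nat i - 1)) gchoose (c i))"
    using assms unfolding has_gotzmann_development_def by blast
  define cs where "cs = map c [1..<Suc s]"
  have nth: "cs ! i = c (Suc i)" if "i < s" for i
    using that by (simp add: cs_def del: upt_Suc)
  have len: "length cs = s" by (simp add: cs_def)
  have "sorted_wrt (\<ge>) cs"
    by (subst sorted_wrt_iff_nth_Suc_transp) (use sc(1) in \<open>auto simp: len nth transp_def\<close>)
  moreover have "(\<Sum>i=1..s. (x + of_nat (c i) - (of_nat i - 1)) gchoose (c i)) =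
      (\<Sum>i<length cs. piece_val (i, cs ! i) x)" for x
  proof -
    have "(\<Sum>i=1..s. (x + of_nat (c i) - (of_nat i - 1)) gchoose (c i)) =
        (\<Sum>i<s. (x + of_nat (c (Suc i)) - (of_nat (Suc i) - 1)) gchoose (c (Suc i)))"
      by (rule sum.reindex_bij_witness[of _ Suc "\<lambda>i. i - 1"]) auto
    then show ?thesis
      by (simp add: len nth piece_val_def algebra_simps)
  qed
  ultimately show thesis
    using sc(2) by (intro that) simp_all
qed

section \<open>Lengths of chains of submodules\<close>

text \<open>When \<open>L\<close> singles out the submodules of a module \<open>V\<close>, this is
  the length of \<open>V / A\<close>, expressed without forming the quotient.\<close>

definition chain_length :: "('x set \<Rightarrow> bool) \<Rightarrow> 'x set \<Rightarrow> enat" where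
  "chain_length L A =
    Sup {enat n | n. \<exists>N. (\<forall>i\<le>n. L (N i)) \<and> A \<subseteq> N 0 \<and> (\<forall>i<n. N i \<subset> N (Suc i))}"

lemma enat_le_iff_finite_le: "x \<le> y \<longleftrightarrow> (\<forall>n. enat n \<le> x \<longrightarrow> enat n \<le> y)"
proof (cases x)
  case infinity
  show ?thesis
  proof
    assume "\<forall>n. enat n \<le> x \<longrightarrow> enat n \<le> y"
    then have *: "enat n \<le> y" for n using infinity by simp
    show "x \<le> y"
    proof (cases y)
      case (enat k)
      then show ?thesis using *[of "Suc k"] by simp
    qed simp
  qed (auto intro: order_trans)
next
  case (enat k)
  then show ?thesis by (auto intro: order_trans[of _ "enat k" y])
qed

lemma chain_length_ge:
  assumes "\<And>i. i \<le> n \<Longrightarrow> L (N i)" "A \<subseteq> N 0" "\<And>i. i < n \<Longrightarrow> N i \<subset> N (Suc i)"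
  shows "enat n \<le> chain_length L A"
  unfolding chain_length_def using assms by (intro Sup_upper) blast

text \<open>The supremum exceeds \<open>n - 1\<close>, so some chain does too, and it is cut off at
  \<open>n\<close>. For \<open>n = 0\<close> there is no predecessor and \<open>A\<close> itself
  serves, whence the premise \<open>L A\<close>.\<close>

lemma chain_of_length:
  assumes "L A" "enat n \<le> chain_length L A"
  obtains N where "\<And>i. i \<le> n \<Longrightarrow> L (N i)" "A \<subseteq> N 0" "\<And>i. i < n \<Longrightarrow> N i \<subset> N (Suc i)"
proof (cases "n = 0")
  case True
  show thesis by (rule that[of "\<lambda>_. A"]) (use True assms in auto)
next
  case False
  then have "enat (n - 1) < chain_length L A"
    using assms(2) by (metis Suc_ile_eq Suc_pred' bot_nat_0.not_eq_extremum)
  then obtain k N where k: "n - 1 < k" "\<forall>i\<le>k. L (N i)" "A \<subseteq> N 0" "\<forall>i<k. N i \<subset> N (Suc i)"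
    unfolding chain_length_def less_Sup_iff by auto
  then show thesis
    by (intro that[of N]) auto
qed

lemma chain_length_antimono: "A \<subseteq> B \<Longrightarrow> chain_length L B \<le> chain_length L A"
  unfolding chain_length_def by (intro Sup_subset_mono) blast

lemma chain_length_step:
  assumes "L A" "enat (Suc n) \<le> chain_length L A"
  obtains B where "L B" "A \<subset> B" "enat n \<le> chain_length L B"
proof -
  obtain N where N: "\<And>i. i \<le> Suc n \<Longrightarrow> L (N i)" "A \<subseteq> N 0" "\<And>i. i < Suc n \<Longrightarrow> N i \<subset> N (Suc i)"
    using chain_of_length[OF assms] by blast
  have "enat n \<le> chain_length L (N 1)"
    by (rule chain_length_ge[of _ _ "\<lambda>i. N (Suc i)"]) (use N in auto)
  moreover have "A \<subset> N 1"
    using N(2) N(3)[of 0] by auto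
  ultimately show thesis
    using that[of "N 1"] N(1)[of 1] by simp
qed

lemma chain_length_psubset:
  assumes "L A" "L B" "A \<subset> B"
  shows "eSuc (chain_length L B) \<le> chain_length L A"
proof -
  have *: "enat (Suc n) \<le> chain_length L A" if n: "enat n \<le> chain_length L B" for n
  proof -
    obtain N where N: "\<And>i. i \<le> n \<Longrightarrow> L (N i)" "B \<subseteq> N 0" "\<And>i. i < n \<Longrightarrow> N i \<subset> N (Suc i)"
      using chain_of_length[OF assms(2) n] by blast
    show ?thesis
    proof (rule chain_length_ge[of _ _ "case_nat A N"])
      show "L (case_nat A N i)" if "i \<le> Suc n" for i
        using that N assms by (cases i) auto
      show "case_nat A N i \<subset> case_nat A N (Suc i)" if "i < Suc n" for i
        using that N assms by (cases i) auto
    qed simp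
  qed
  show ?thesis
  proof (subst enat_le_iff_finite_le, intro allI impI)
    fix n assume n: "enat n \<le> eSuc (chain_length L B)"
    show "enat n \<le> chain_length L A"
    proof (cases n)
      case 0
      then show ?thesis by (metis i0_lb zero_enat_def)
    next
      case (Suc k)
      then have "enat k \<le> chain_length L B"
        using n by (metis eSuc_enat eSuc_ile_mono)
      then show ?thesis unfolding Suc by (rule *)
    qed
  qed
qed

lemma chain_length_eq_0:
  assumes "L A" "\<And>B. L B \<Longrightarrow> \<not> A \<subset> B"
  shows "chain_length L A = 0"
proof (rule ccontr)
  assume "chain_length L A \<noteq> 0"
  then have "enat (Suc 0) \<le> chain_length L A"
    by (metis Suc_ile_eq i0_less zero_enat_def)
  then show False
    using chain_length_step[of L A 0] assms by metis
qed

section \<open>Leading coefficients of submodules of a free module\<close>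

text \<open>One predicate serves both for ideals of the coefficient ring and for submodules of
  polynomials, according to the scaling. Negatives come from the scalar \<open>- 1\<close>.\<close>

definition submod :: "('a::comm_ring_1 \<Rightarrow> 'b::ab_group_add \<Rightarrow> 'b) \<Rightarrow> 'b set \<Rightarrow> bool" where
  "submod sc S \<longleftrightarrow> 0 \<in> S \<and> (\<forall>x\<in>S. \<forall>y\<in>S. x + y \<in> S) \<and> (\<forall>r. \<forall>x\<in>S. sc r x \<in> S)"

definition poly_scale :: "'a::comm_ring_1 \<Rightarrow> ('k \<Rightarrow>\<^sub>0 'a) \<Rightarrow> ('k \<Rightarrow>\<^sub>0 'a)" where
  "poly_scale r p = Poly_Mapping.map ((*) r) p"

lemma lookup_poly_scale [simp]: "Poly_Mapping.lookup (poly_scale r p) m = r * Poly_Mapping.lookup p m"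
  by (simp add: poly_scale_def map.rep_eq when_def)

lemma keys_poly_scale: "Poly_Mapping.keys (poly_scale r p) \<subseteq> Poly_Mapping.keys p"
  by (auto simp: in_keys_iff)

lemma poly_scale_minus_one: "poly_scale (- 1) p = - p"
  by (rule poly_mapping_eqI) simp

lemma submod_diff:
  "submod poly_scale S \<Longrightarrow> p \<in> S \<Longrightarrow> q \<in> S \<Longrightarrow> p - q \<in> S"
  unfolding submod_def by (metis add_uminus_conv_diff poly_scale_minus_one)

definition supported :: "'k set \<Rightarrow> ('k \<Rightarrow>\<^sub>0 'a::comm_ring_1) set" where
  "supported M = {p. Poly_Mapping.keys p \<subseteq> M}"

text \<open>Asking only that no key exceeds \<open>m\<close>, rather than that \<open>m\<close> is
  the largest key, admits the coefficient \<open>0\<close> and makes this an ideal.\<close>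

definition lead :: "('k::linorder \<Rightarrow>\<^sub>0 'a::comm_ring_1) set \<Rightarrow> 'k \<Rightarrow> 'a set" where
  "lead S m = {Poly_Mapping.lookup p m | p. p \<in> S \<and> Poly_Mapping.keys p \<subseteq> {..m}}"

lemma leadI: "p \<in> S \<Longrightarrow> Poly_Mapping.keys p \<subseteq> {..m} \<Longrightarrow> Poly_Mapping.lookup p m \<in> lead S m"
  unfolding lead_def by blast

lemma leadE:
  assumes "x \<in> lead S m"
  obtains p where "p \<in> S" "Poly_Mapping.keys p \<subseteq> {..m}" "x = Poly_Mapping.lookup p m"
  using assms unfolding lead_def by blast

lemma keys_plus_subset:
  "Poly_Mapping.keys p \<subseteq> K \<Longrightarrow> Poly_Mapping.keys q \<subseteq> K \<Longrightarrow> Poly_Mapping.keys (p + q) \<subseteq> K"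
  using keys_add[of p q] by blast

lemma submod_supported: "submod poly_scale (supported M)"
  using keys_poly_scale by (force simp: submod_def supported_def dest: keys_plus_subset)

lemma submod_lead:
  assumes "submod poly_scale S"
  shows "submod (*) (lead S m)"
  unfolding submod_def
proof (intro conjI ballI allI)
  show "0 \<in> lead S m"
    using leadI[of 0 S m] assms by (simp add: submod_def)
next
  fix x y assume "x \<in> lead S m" "y \<in> lead S m"
  then obtain p q where pq: "p \<in> S" "Poly_Mapping.keys p \<subseteq> {..m}" "x = Poly_Mapping.lookup p m"
    "q \<in> S" "Poly_Mapping.keys q \<subseteq> {..m}" "y = Poly_Mapping.lookup q m"
    by (elim leadE)
  then have "p + q \<in> S"
    using assms by (simp add: submod_def)
  then show "x + y \<in> lead S m"
    using leadI[of "p + q" S m] keys_plus_subset[OF pq(2,5)] pq(3,6) by (simp add: lookup_add)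
next
  fix r x assume "x \<in> lead S m"
  then obtain p where p: "p \<in> S" "Poly_Mapping.keys p \<subseteq> {..m}" "x = Poly_Mapping.lookup p m"
    by (elim leadE)
  then have "poly_scale r p \<in> S"
    using assms by (simp add: submod_def)
  then show "r * x \<in> lead S m"
    using leadI[of "poly_scale r p" S m] keys_poly_scale[of r p] p(2,3) by fastforce
qed

lemma lead_mono: "S \<subseteq> T \<Longrightarrow> lead S m \<subseteq> lead T m"
  by (blast intro: leadI elim: leadE)

text \<open>Division: subtracting an element of \<open>S\<close> with the same leading coefficient
  lowers the leading monomial. The measure counts the elements of \<open>M\<close> lying below some
  key.\<close>

lemma subset_if_lead_eq:
  fixes S T :: "('k::linorder \<Rightarrow>\<^sub>0 'a::comm_ring_1) set"
  assumes "finite M" "submod poly_scale S" "submod poly_scale T" "S \<subseteq> T" "T \<subseteq> supported M"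
    and lead: "\<And>m. m \<in> M \<Longrightarrow> lead T m \<subseteq> lead S m"
  shows "T \<subseteq> S"
proof -
  have "p \<in> S" if "p \<in> T" for p
    using that
  proof (induction p rule: measure_induct_rule[of "\<lambda>p. card {m\<in>M. \<exists>k\<in>Poly_Mapping.keys p. m \<le> k}"])
    case (less p)
    show ?case
    proof (cases "p = 0")
      case True
      then show ?thesis using assms(2) by (simp add: submod_def)
    next
      case False
      define m where "m = Max (Poly_Mapping.keys p)"
      have m: "m \<in> Poly_Mapping.keys p"
        unfolding m_def using False by (intro Max_in) (auto simp: keys_eq_empty)
      have m_max: "k \<le> m" if "k \<in> Poly_Mapping.keys p" for k
        unfolding m_def using that by (intro Max_ge) auto
      have "m \<in> M"
        using m less.prems assms(5) by (auto simp: supported_def)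
      moreover have "Poly_Mapping.lookup p m \<in> lead T m"
        using less.prems m_max by (intro leadI) auto
      ultimately have "Poly_Mapping.lookup p m \<in> lead S m"
        using lead by blast
      then obtain q where q: "q \<in> S" "Poly_Mapping.lookup q m = Poly_Mapping.lookup p m"
        "Poly_Mapping.keys q \<subseteq> {..m}"
        by (metis leadE)
      have less_m: "k < m" if "k \<in> Poly_Mapping.keys (p - q)" for k
      proof -
        have "k \<noteq> m" using that q(2) by (auto simp: in_keys_iff lookup_minus)
        moreover have "k \<le> m"
          using that keys_diff[of p q] m_max q(3) by (auto simp: subset_iff)
        ultimately show ?thesis by simp
      qed
      have "{x \<in> M. \<exists>k\<in>Poly_Mapping.keys (p - q). x \<le> k} \<subset> {x \<in> M. \<exists>k\<in>Poly_Mapping.keys p. x \<le> k}"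
      proof (rule psubsetI)
        show "{x \<in> M. \<exists>k\<in>Poly_Mapping.keys (p - q). x \<le> k} \<subseteq> {x \<in> M. \<exists>k\<in>Poly_Mapping.keys p. x \<le> k}"
          using m less_m by (auto dest!: less_imp_le intro: order_trans)
        have "m \<notin> {x \<in> M. \<exists>k\<in>Poly_Mapping.keys (p - q). x \<le> k}"
          using less_m leD by blast
        moreover have "m \<in> {x \<in> M. \<exists>k\<in>Poly_Mapping.keys p. x \<le> k}"
          using m \<open>m \<in> M\<close> by blast
        ultimately show "{x \<in> M. \<exists>k\<in>Poly_Mapping.keys (p - q). x \<le> k} \<noteq> {x \<in> M. \<exists>k\<in>Poly_Mapping.keys p. x \<le> k}"
          by blast
      qed
      then have "card {x \<in> M. \<exists>k\<in>Poly_Mapping.keys (p - q). x \<le> k}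
          < card {x \<in> M. \<exists>k\<in>Poly_Mapping.keys p. x \<le> k}"
        using assms(1) by (intro psubset_card_mono) auto
      moreover have "p - q \<in> T"
        using submod_diff[OF assms(3) less.prems] q(1) assms(4) by blast
      ultimately have "p - q \<in> S"
        using less.IH by blast
      then have "(p - q) + q \<in> S"
        using assms(2) q(1) unfolding submod_def by blast
      then show ?thesis by simp
    qed
  qed
  then show ?thesis by blast
qed

lemma sum_enat_antimono_strict:
  fixes f g :: "'k \<Rightarrow> enat"
  assumes "finite M" "m \<in> M" "eSuc (f m) \<le> g m" "\<And>x. x \<in> M \<Longrightarrow> f x \<le> g x"
  shows "eSuc (sum f M) \<le> sum g M"
proof -
  have "eSuc (sum f M) = eSuc (f m) + sum f (M - {m})"
    using assms(1,2) by (simp add: sum.remove iadd_Suc)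
  also have "\<dots> \<le> g m + sum g (M - {m})"
    using assms(3,4) by (intro add_mono sum_mono) auto
  also have "\<dots> = sum g M"
    using assms(1,2) by (simp add: sum.remove)
  finally show ?thesis .
qed

text \<open>By \<open>subset_if_lead_eq\<close>, each strict step of a chain strictly enlarges some
  leading ideal, which uses up one unit of the sum.\<close>

lemma chain_length_le_sum_lead:
  fixes S :: "('k::linorder \<Rightarrow>\<^sub>0 'a::comm_ring_1) set"
  assumes "finite M" "submod poly_scale S" "S \<subseteq> supported M"
    and "enat n \<le> chain_length (\<lambda>T. submod poly_scale T \<and> T \<subseteq> supported M) S"
  shows "enat n \<le> (\<Sum>m\<in>M. chain_length (submod (*)) (lead S m))"
  using assms(2-4)
proof (induction n arbitrary: S)
  case 0
  show ?case by (metis i0_lb zero_enat_def)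
next
  case (Suc n)
  let ?L = "\<lambda>T. submod poly_scale T \<and> T \<subseteq> supported M"
  have "?L S" using Suc.prems by simp
  from chain_length_step[of ?L S n, OF this Suc.prems(3)]
  obtain T where "?L T" and T: "S \<subset> T" "enat n \<le> chain_length ?L T" .
  then have subT: "submod poly_scale T" "T \<subseteq> supported M" by auto
  have "S \<subseteq> T" "\<not> T \<subseteq> S" using T(1) by auto
  then obtain m where m: "m \<in> M" "\<not> lead T m \<subseteq> lead S m"
    using subset_if_lead_eq[OF assms(1) Suc.prems(1) subT(1) _ subT(2)] by auto
  have "lead S m \<subset> lead T m"
    using lead_mono[OF \<open>S \<subseteq> T\<close>, of m] m(2) by auto
  then have "eSuc (chain_length (submod (*)) (lead T m)) \<le> chain_length (submod (*)) (lead S m)"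
    by (intro chain_length_psubset submod_lead subT(1) Suc.prems(1))
  moreover have "chain_length (submod (*)) (lead T x) \<le> chain_length (submod (*)) (lead S x)" for x
    using \<open>S \<subseteq> T\<close> by (intro chain_length_antimono lead_mono)
  ultimately have "eSuc (\<Sum>m\<in>M. chain_length (submod (*)) (lead T m))
      \<le> (\<Sum>m\<in>M. chain_length (submod (*)) (lead S m))"
    using assms(1) m(1) by (intro sum_enat_antimono_strict)
  moreover have "enat (Suc n) \<le> eSuc (\<Sum>m\<in>M. chain_length (submod (*)) (lead T m))"
    using Suc.IH[OF subT T(2)] by (metis eSuc_enat eSuc_ile_mono)
  ultimately show ?case by (rule order_trans[rotated])
qed

text \<open>Takes one unit off the nonzero summand. An infinite summand has no predecessor, so there
  a large enough finite \<open>k\<close> stands in.\<close>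

lemma enat_Suc_le_addE:
  assumes "enat (Suc n) \<le> x + y" "x \<noteq> 0"
  obtains k where "enat (Suc k) \<le> x" "enat n \<le> enat k + y"
proof (cases x)
  case (enat j)
  show thesis
  proof (rule that[of "j - 1"])
    show "enat (Suc (j - 1)) \<le> x"
      using assms(2) enat by (cases j) (auto simp: zero_enat_def)
    show "enat n \<le> enat (j - 1) + y"
      using assms enat by (cases y; cases j) (auto simp: zero_enat_def)
  qed
next
  case infinity
  show thesis by (rule that[of n]) (auto simp: infinity intro: add_increasing2)
qed

text \<open>Enlarging \<open>S\<close> at the smallest monomial \<open>m\<close> whose leading ideal is proper, together with
  everything below \<open>m\<close>, changes no leading ideal above \<open>m\<close>.\<close>

lemma sum_lead_le_chain_length:
  fixes S :: "('k::linorder \<Rightarrow>\<^sub>0 'a::comm_ring_1) set"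
  assumes "finite M" "submod poly_scale S" "S \<subseteq> supported M"
    and "enat n \<le> (\<Sum>m\<in>M. chain_length (submod (*)) (lead S m))"
  shows "enat n \<le> chain_length (\<lambda>T. submod poly_scale T \<and> T \<subseteq> supported M) S"
  using assms(2-4)
proof (induction n arbitrary: S)
  case 0
  show ?case by (metis i0_lb zero_enat_def)
next
  case (Suc n)
  let ?a = "\<lambda>S m. chain_length (submod (*)) (lead S m)"
  define m where "m = Min {m \<in> M. ?a S m \<noteq> 0}"
  have "(\<Sum>m\<in>M. ?a S m) \<noteq> 0"
    using Suc.prems(3) by (metis Suc_ile_eq not_iless0 zero_enat_def)
  then have ne: "{m \<in> M. ?a S m \<noteq> 0} \<noteq> {}"
    by (metis (mono_tags, lifting) empty_Collect_eq sum.neutral)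
  have fin: "finite {m \<in> M. ?a S m \<noteq> 0}"
    using assms(1) by simp
  have m: "m \<in> M" "?a S m \<noteq> 0"
    using Min_in[OF fin ne] by (auto simp: m_def)
  have below: "?a S x = 0" if "x \<in> M" "x < m" for x
    using Min_le[OF fin, of x] that by (force simp: m_def)
  have "enat (Suc n) \<le> ?a S m + (\<Sum>x\<in>M - {m}. ?a S x)"
    using Suc.prems(3) assms(1) m(1) by (simp add: sum.remove)
  then obtain k where k: "enat (Suc k) \<le> ?a S m" "enat n \<le> enat k + (\<Sum>x\<in>M - {m}. ?a S x)"
    using enat_Suc_le_addE m(2) by metis
  obtain J where J: "submod (*) J" "lead S m \<subset> J" "enat k \<le> chain_length (submod (*)) J"
    by (rule chain_length_step[OF submod_lead[OF Suc.prems(1)] k(1)])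
  define B where "B = {q \<in> supported M. Poly_Mapping.keys q \<subseteq> {..m} \<and> Poly_Mapping.lookup q m \<in> J}"
  define T where "T = {p + q | p q. p \<in> S \<and> q \<in> B}"
  have B: "submod poly_scale B"
    unfolding submod_def
  proof (intro conjI ballI allI)
    show "0 \<in> B" using J(1) by (simp add: B_def supported_def submod_def)
  next
    fix x y assume "x \<in> B" "y \<in> B"
    then show "x + y \<in> B"
      using J(1) submod_supported[of M] keys_plus_subset[of x "{..m}" y]
      by (auto simp: B_def submod_def lookup_add)
  next
    fix r x assume "x \<in> B"
    then show "poly_scale r x \<in> B"
      using J(1) submod_supported[of M] keys_poly_scale[of r x]
      by (auto simp: B_def submod_def)
  qed
  have TI: "p + q \<in> T" if "p \<in> S" "q \<in> B" for p q
    using that unfolding T_def by blast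
  have TE: "\<exists>p\<in>S. \<exists>q\<in>B. x = p + q" if "x \<in> T" for x
    using that unfolding T_def by blast
  have zero: "0 \<in> S" "0 \<in> B"
    using Suc.prems(1) B by (simp_all add: submod_def)
  have T: "submod poly_scale T"
    unfolding submod_def
  proof (intro conjI ballI allI)
    show "0 \<in> T" using TI[OF zero] by simp
  next
    fix x y assume "x \<in> T" "y \<in> T"
    then obtain p q p' q' where pq: "p \<in> S" "q \<in> B" "x = p + q" "p' \<in> S" "q' \<in> B" "y = p' + q'"
      by (auto dest!: TE)
    have "(p + p') + (q + q') \<in> T"
      using Suc.prems(1) B pq by (intro TI) (simp_all add: submod_def)
    then show "x + y \<in> T" by (simp add: pq ac_simps)
  next
    fix r x assume "x \<in> T"
    then obtain p q where pq: "p \<in> S" "q \<in> B" "x = p + q"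
      by (auto dest!: TE)
    have "poly_scale r p + poly_scale r q \<in> T"
      using Suc.prems(1) B pq by (intro TI) (simp_all add: submod_def)
    moreover have "poly_scale r x = poly_scale r p + poly_scale r q"
      unfolding pq(3) by (rule poly_mapping_eqI) (simp add: lookup_add distrib_left)
    ultimately show "poly_scale r x \<in> T" by simp
  qed
  have T_sub: "T \<subseteq> supported M"
  proof
    fix x assume "x \<in> T"
    then obtain p q where pq: "p \<in> S" "q \<in> B" "x = p + q"
      by (auto dest!: TE)
    then have "p \<in> supported M" "q \<in> supported M"
      using Suc.prems(2) by (auto simp: B_def)
    then show "x \<in> supported M"
      using submod_supported[of M] unfolding submod_def pq(3) by blast
  qed
  have "S \<subseteq> T"
    using TI[OF _ zero(2)] by auto
  have lead_m: "lead T m \<subseteq> J"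
  proof
    fix r assume "r \<in> lead T m"
    then obtain p q where pq: "p \<in> S" "q \<in> B" "Poly_Mapping.keys (p + q) \<subseteq> {..m}"
      "r = Poly_Mapping.lookup (p + q) m"
      by (elim leadE) (auto dest!: TE)
    \<comment> \<open>Subtracting \<open>q\<close>, whose keys are at most \<open>m\<close>, shows
      that \<open>p\<close> has no higher terms either, so its coefficient at \<open>m\<close> is a
      leading coefficient of \<open>S\<close>.\<close>
    have "Poly_Mapping.keys p \<subseteq> {..m}"
      using pq(2,3) keys_diff[of "p + q" q] by (auto simp: B_def)
    then have "Poly_Mapping.lookup p m \<in> J"
      using leadI[OF pq(1)] J(2) by blast
    then show "r \<in> J"
      using pq(2,4) J(1) by (simp add: lookup_add B_def submod_def)
  qed
  have lead_above: "lead T x \<subseteq> lead S x" if "x > m" for x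
  proof
    fix r assume "r \<in> lead T x"
    then obtain p q where pq: "p \<in> S" "q \<in> B" "Poly_Mapping.keys (p + q) \<subseteq> {..x}"
      "r = Poly_Mapping.lookup (p + q) x"
      by (elim leadE) (auto dest!: TE)
    have "Poly_Mapping.keys q \<subseteq> {..m}" using pq(2) by (simp add: B_def)
    then have q: "Poly_Mapping.keys q \<subseteq> {..x}" "Poly_Mapping.lookup q x = 0"
      using that by (auto simp: in_keys_iff dest: subsetD)
    then have "Poly_Mapping.keys p \<subseteq> {..x}"
      using pq(3) keys_diff[of "p + q" q] by auto
    then show "r \<in> lead S x"
      using leadI[OF pq(1)] pq(4) q(2) by (simp add: lookup_add)
  qed
  have "\<not> T \<subseteq> S"
  proof
    assume "T \<subseteq> S"
    obtain r where r: "r \<in> J" "r \<notin> lead S m" using J(2) by blast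
    have "Poly_Mapping.single m r \<in> B"
      using r(1) m(1) by (auto simp: B_def supported_def)
    then have "0 + Poly_Mapping.single m r \<in> T" by (rule TI[OF zero(1)])
    then have "Poly_Mapping.single m r \<in> S" using \<open>T \<subseteq> S\<close> by auto
    then have "Poly_Mapping.lookup (Poly_Mapping.single m r) m \<in> lead S m"
      by (rule leadI) simp
    then show False using r(2) by simp
  qed
  then have psub: "S \<subset> T" using \<open>S \<subseteq> T\<close> by blast
  have "?a S x \<le> ?a T x" if "x \<in> M - {m}" for x
  \<comment> \<open>Below \<open>m\<close> the leading ideals of \<open>S\<close> have length
    \<open>0\<close> above them, so enlarging them costs nothing; this is why \<open>m\<close> is
    minimal.\<close>
  proof (cases "x < m")
    case True
    then show ?thesis using below[of x] that by simp
  next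
    case False
    then show ?thesis using that by (intro chain_length_antimono lead_above) auto
  qed
  moreover have "enat k \<le> ?a T m"
    using J(3) chain_length_antimono[OF lead_m] by (rule order_trans)
  ultimately have "enat k + (\<Sum>x\<in>M - {m}. ?a S x) \<le> ?a T m + (\<Sum>x\<in>M - {m}. ?a T x)"
    by (intro add_mono sum_mono)
  then have "enat n \<le> (\<Sum>x\<in>M. ?a T x)"
    using k(2) assms(1) m(1) by (simp add: sum.remove)
  then have "enat n \<le> chain_length (\<lambda>T. submod poly_scale T \<and> T \<subseteq> supported M) T"
    by (rule Suc.IH[OF T T_sub])
  then have "enat (Suc n) \<le> eSuc (chain_length (\<lambda>T. submod poly_scale T \<and> T \<subseteq> supported M) T)"
    by (metis eSuc_enat eSuc_ile_mono)
  also have "\<dots> \<le> chain_length (\<lambda>T. submod poly_scale T \<and> T \<subseteq> supported M) S"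
    using Suc.prems(1,2) T T_sub psub by (intro chain_length_psubset) auto
  finally show ?case .
qed

lemma chain_length_eq_sum_lead:
  fixes S :: "('k::linorder \<Rightarrow>\<^sub>0 'a::comm_ring_1) set"
  assumes "finite M" "submod poly_scale S" "S \<subseteq> supported M"
  shows "chain_length (\<lambda>T. submod poly_scale T \<and> T \<subseteq> supported M) S =
    (\<Sum>m\<in>M. chain_length (submod (*)) (lead S m))"
  by (intro order_antisym; subst enat_le_iff_finite_le)
    (use chain_length_le_sum_lead[OF assms] sum_lead_le_chain_length[OF assms] in blast)+

section \<open>Graded pieces of a standard algebra\<close>

lemma mpoly_ring_simps:
  "carrier (mpoly_ring b) = supported (monoms {..<b})"
  "add (mpoly_ring b) = (+)"
  "monoid.mult (mpoly_ring b) = (*)"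
  "zero (mpoly_ring b) = 0"
  "one (mpoly_ring b) = 1"
  by (auto simp: mpoly_ring_def ring_of_type_algebra_def supported_def monoms_def)

lemma homogeneous_polys_eq:
  "homogeneous_polys b n = supported {m \<in> monoms {..<b}. monom_degree m = n}"
  by (auto simp: homogeneous_polys_def mpoly_ring_simps supported_def)

lemma homogeneous_polys_subset: "homogeneous_polys b n \<subseteq> carrier (mpoly_ring b)"
  by (auto simp: homogeneous_polys_def)

lemma single_times_eq_poly_scale: "Poly_Mapping.single 0 r * p = poly_scale r p"
  by (simp add: poly_scale_def mult_map_scale_conv_mult)

lemma ring_mpoly_ring: "ring (mpoly_ring b :: 'a::comm_ring_1 mpoly ring)"
proof -
  interpret R: ring "ring_of_type_algebra :: 'a mpoly ring"
    by (rule ring_from_type_algebra)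
  have minus: "\<ominus>\<^bsub>ring_of_type_algebra\<^esub> p = - p" for p :: "'a mpoly"
    by (rule R.minus_equality) (simp_all add: ring_of_type_algebra_def)
  let ?C = "supported (monoms {..<b}) :: 'a mpoly set"
  have "subring ?C ring_of_type_algebra"
  proof (rule R.subringI)
    show "?C \<subseteq> carrier ring_of_type_algebra"
      by (simp add: ring_of_type_algebra_def)
    show "\<one>\<^bsub>ring_of_type_algebra\<^esub> \<in> ?C"
      by (simp add: ring_of_type_algebra_def supported_def monoms_def)
    show "\<ominus>\<^bsub>ring_of_type_algebra\<^esub> p \<in> ?C" if "p \<in> ?C" for p
      using that submod_supported[of "monoms {..<b}"] unfolding minus submod_def
      by (metis poly_scale_minus_one)
    show "p \<otimes>\<^bsub>ring_of_type_algebra\<^esub> q \<in> ?C" if "p \<in> ?C" "q \<in> ?C" for p q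
    proof -
      have "Poly_Mapping.keys (p * q) \<subseteq> monoms {..<b}"
        using keys_mult[of p q] that by (fastforce simp: supported_def monoms_def keys_plus_nat)
      then show ?thesis by (simp add: ring_of_type_algebra_def supported_def)
    qed
    show "p \<oplus>\<^bsub>ring_of_type_algebra\<^esub> q \<in> ?C" if "p \<in> ?C" "q \<in> ?C" for p q
      using that keys_plus_subset[of p _ q] by (simp add: ring_of_type_algebra_def supported_def)
  qed
  then have "ring (ring_of_type_algebra\<lparr>carrier := ?C\<rparr>)"
    by (rule R.subring_is_ring)
  moreover have "mpoly_ring b = ring_of_type_algebra\<lparr>carrier := ?C\<rparr>"
    by (simp add: mpoly_ring_def supported_def monoms_def subset_iff Ball_def)
  ultimately show ?thesis by simp
qed

lemma ideal_mpolyD: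
  assumes "ideal I (mpoly_ring b)"
  shows "submod poly_scale I" "I \<subseteq> carrier (mpoly_ring b)"
    "\<And>p x. p \<in> carrier (mpoly_ring b) \<Longrightarrow> x \<in> I \<Longrightarrow> p * x \<in> I"
proof -
  interpret ideal I "mpoly_ring b" by fact
  show sub: "I \<subseteq> carrier (mpoly_ring b)" by (rule a_subset)
  show mult: "p * x \<in> I" if "p \<in> carrier (mpoly_ring b)" "x \<in> I" for p x
    using I_l_closed[OF that(2,1)] by (simp add: mpoly_ring_simps)
  have "poly_scale r x \<in> I" if "x \<in> I" for r x
  proof -
    have "Poly_Mapping.single 0 r \<in> carrier (mpoly_ring b)"
      by (simp add: mpoly_ring_simps supported_def monoms_def)
    then show ?thesis using mult[OF _ that] by (metis single_times_eq_poly_scale)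
  qed
  moreover have "0 \<in> I"
    using additive_subgroup.zero_closed[OF is_additive_subgroup] by (simp add: mpoly_ring_simps)
  moreover have "x + y \<in> I" if "x \<in> I" "y \<in> I" for x y
    using additive_subgroup.a_closed[OF is_additive_subgroup that] by (simp add: mpoly_ring_simps)
  ultimately show "submod poly_scale I" by (simp add: submod_def)
qed

lemma coset_mpoly: "I +>\<^bsub>mpoly_ring b\<^esub> p = (\<lambda>i. i + p) ` I"
  by (auto simp: a_r_coset_def r_coset_def mpoly_ring_simps)

lemma coset_eq_iff:
  fixes I :: "('k \<Rightarrow>\<^sub>0 'a::comm_ring_1) set"
  assumes "submod poly_scale I"
  shows "(\<lambda>i. i + p) ` I = (\<lambda>i. i + q) ` I \<longleftrightarrow> p - q \<in> I"
proof
  assume eq: "(\<lambda>i. i + p) ` I = (\<lambda>i. i + q) ` I"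
  have "0 + p \<in> (\<lambda>i. i + p) ` I"
    using assms by (intro imageI) (simp add: submod_def)
  then obtain i where "i \<in> I" "0 + p = i + q" unfolding eq by blast
  then show "p - q \<in> I" by (simp add: algebra_simps)
next
  have sub: "(\<lambda>i. i + p) ` I \<subseteq> (\<lambda>i. i + q) ` I" if "p - q \<in> I" for p q
  proof
    fix x assume "x \<in> (\<lambda>i. i + p) ` I"
    then obtain i where "i \<in> I" "x = i + p" by blast
    then have "i + (p - q) \<in> I" "x = (i + (p - q)) + q"
      using assms that by (simp_all add: submod_def)
    then show "x \<in> (\<lambda>i. i + q) ` I" by blast
  qed
  assume pq: "p - q \<in> I"
  then have "poly_scale (- 1) (p - q) \<in> I" using assms by (simp add: submod_def)
  then have "q - p \<in> I" by (simp add: poly_scale_minus_one)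
  with pq sub[of p q] sub[of q p] show "(\<lambda>i. i + p) ` I = (\<lambda>i. i + q) ` I" by blast
qed

lemma graded_piece_simps:
  fixes I :: "'a::comm_ring_1 mpoly set" and n :: nat
  assumes I: "ideal I (mpoly_ring b)"
  defines "G \<equiv> graded_piece b I n"
  defines "cl \<equiv> \<lambda>p. (\<lambda>i. i + p) ` I"
  shows "carrier G = cl ` homogeneous_polys b n"
    and "zero G = cl 0"
    and "add G (cl p) (cl q) = cl (p + q)"
    and "p \<in> homogeneous_polys b n \<Longrightarrow> module.smult G r (cl p) = cl (poly_scale r p)"
proof -
  show "carrier G = cl ` homogeneous_polys b n"
    by (simp add: G_def cl_def graded_piece_def coset_mpoly[abs_def])
  show "zero G = cl 0"
    by (simp add: G_def cl_def graded_piece_def standard_algebra_def Let_def FactRing_def)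
  have "add G (cl p) (cl q) = {x + y | x y. x \<in> cl p \<and> y \<in> cl q}"
    by (auto simp: G_def graded_piece_def standard_algebra_def Let_def FactRing_def set_add_def
        set_mult_def mpoly_ring_simps)
  also have "\<dots> = cl (p + q)"
  proof (intro equalityI subsetI)
    fix z assume "z \<in> {x + y | x y. x \<in> cl p \<and> y \<in> cl q}"
    then obtain i j where "i \<in> I" "j \<in> I" "z = (i + j) + (p + q)"
      by (auto simp: cl_def ac_simps)
    moreover from this have "i + j \<in> I"
      using ideal_mpolyD(1)[OF I] by (simp add: submod_def)
    ultimately show "z \<in> cl (p + q)" unfolding cl_def by blast
  next
    fix z assume "z \<in> cl (p + q)"
    then obtain i where i: "i \<in> I" "z = (i + p) + (0 + q)"
      by (auto simp: cl_def ac_simps)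
    moreover have "0 \<in> I"
      using ideal_mpolyD(1)[OF I] by (simp add: submod_def)
    ultimately show "z \<in> {x + y | x y. x \<in> cl p \<and> y \<in> cl q}"
      unfolding cl_def by blast
  qed
  finally show "add G (cl p) (cl q) = cl (p + q)" .
  show "module.smult G r (cl p) = cl (poly_scale r p)" if p: "p \<in> homogeneous_polys b n"
  proof -
    interpret ideal I "mpoly_ring b" by fact
    have "module.smult G r (cl p) =
        rcoset_mult (mpoly_ring b) I (I +>\<^bsub>mpoly_ring b\<^esub> Poly_Mapping.single 0 r) (I +>\<^bsub>mpoly_ring b\<^esub> p)"
      by (simp add: G_def cl_def graded_piece_def standard_algebra_def Let_def FactRing_def coset_mpoly)
    also have "\<dots> = I +>\<^bsub>mpoly_ring b\<^esub> (Poly_Mapping.single 0 r \<otimes>\<^bsub>mpoly_ring b\<^esub> p)"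
    proof (rule rcoset_mult_add)
      show "Poly_Mapping.single 0 r \<in> carrier (mpoly_ring b)"
        by (simp add: mpoly_ring_simps supported_def monoms_def)
      show "p \<in> carrier (mpoly_ring b)"
        using p homogeneous_polys_subset by blast
    qed
    finally show ?thesis
      by (simp add: mpoly_ring_simps single_times_eq_poly_scale coset_mpoly cl_def)
  qed
qed

text \<open>Correspondence theorem: submodules of the graded piece match submodules of the
  homogeneous polynomials that contain the degree-\<open>n\<close> part of \<open>I\<close>, by
  preimage and image.\<close>

lemma module_length_graded_piece:
  fixes I :: "'a::comm_ring_1 mpoly set"
  assumes I: "ideal I (mpoly_ring b)"
  shows "module_length ring_of_type_algebra (graded_piece b I n) =
    chain_length (\<lambda>T. submod poly_scale T \<and> T \<subseteq> homogeneous_polys b n) (I \<inter> homogeneous_polys b n)"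
proof -
  let ?R = "ring_of_type_algebra :: 'a ring"
  let ?V = "homogeneous_polys b n :: 'a mpoly set"
  define G where "G = graded_piece b I n"
  define cl where "cl p = (\<lambda>i. i + p) ` I" for p
  define lift where "lift N = {p \<in> ?V. cl p \<in> N}" for N
  note sI = ideal_mpolyD(1)[OF I]
  note Gs = graded_piece_simps[OF I, where n = n, folded G_def cl_def]
  note cl_eq = coset_eq_iff[OF sI, folded cl_def]
  have V: "submod poly_scale ?V"
    unfolding homogeneous_polys_eq by (rule submod_supported)
  have lift_image: "cl ` lift N = N" if "submodule N ?R G" for N
  proof -
    interpret submodule N ?R G by fact
    have "N \<subseteq> carrier G" using subset by simp
    then show ?thesis unfolding lift_def Gs(1) by blast
  qed
  have submod_lift: "submod poly_scale (lift N)" and lift_ge: "I \<inter> ?V \<subseteq> lift N"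
    if "submodule N ?R G" for N
  proof -
    interpret submodule N ?R G by fact
    have zero: "cl 0 \<in> N" using one_closed by (simp add: Gs)
    show "submod poly_scale (lift N)"
      unfolding submod_def
    proof (intro conjI ballI allI)
      show "0 \<in> lift N" using zero V by (simp add: lift_def submod_def)
    next
      fix p q assume "p \<in> lift N" "q \<in> lift N"
      then have pq: "p \<in> ?V" "q \<in> ?V" "cl p \<in> N" "cl q \<in> N" by (simp_all add: lift_def)
      have "cl (p + q) \<in> N" using m_closed[OF pq(3,4)] by (simp add: Gs)
      then show "p + q \<in> lift N" using pq V by (simp add: lift_def submod_def)
    next
      fix r p assume "p \<in> lift N"
      then have p: "p \<in> ?V" "cl p \<in> N" by (simp_all add: lift_def)
      have "cl (poly_scale r p) \<in> N"
        using smult_closed[OF _ p(2), of r] Gs(4)[OF p(1)] by (simp add: ring_of_type_algebra_def)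
      then show "poly_scale r p \<in> lift N" using p V by (simp add: lift_def submod_def)
    qed
    show "I \<inter> ?V \<subseteq> lift N"
    proof
      fix p assume p: "p \<in> I \<inter> ?V"
      then have "cl p = cl 0" by (simp add: cl_eq)
      then show "p \<in> lift N" using zero p by (simp add: lift_def)
    qed
  qed
  have submodule_image: "submodule (cl ` T) ?R G" and lift_of_image: "lift (cl ` T) = T"
    if T: "submod poly_scale T" "T \<subseteq> ?V" "I \<inter> ?V \<subseteq> T" for T
  proof -
    have neg: "- p \<in> T" if "p \<in> T" for p
      using T(1) that unfolding submod_def by (metis poly_scale_minus_one)
    show "submodule (cl ` T) ?R G"
    proof (intro submodule.intro subgroup.intro submodule_axioms.intro)
      show "cl ` T \<subseteq> carrier (add_monoid G)"
        using T(2) by (auto simp: Gs)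
      show "x \<otimes>\<^bsub>add_monoid G\<^esub> y \<in> cl ` T" if "x \<in> cl ` T" "y \<in> cl ` T" for x y
        using that T(1) by (auto simp: Gs submod_def)
      show "\<one>\<^bsub>add_monoid G\<^esub> \<in> cl ` T"
        using T(1) by (auto simp: Gs submod_def)
      show "inv\<^bsub>add_monoid G\<^esub> x \<in> cl ` T" if "x \<in> cl ` T" for x
      proof -
        obtain p where p: "p \<in> T" "x = cl p" using \<open>x \<in> cl ` T\<close> by blast
        have "inv\<^bsub>add_monoid G\<^esub> x = cl (- p)"
          \<comment> \<open>No group structure on the graded piece has been set up, so the inverse
            is read off its definite description.\<close>
          unfolding m_inv_def
        proof (rule the_equality)
          show "cl (- p) \<in> carrier (add_monoid G) \<and> x \<otimes>\<^bsub>add_monoid G\<^esub> cl (- p) = \<one>\<^bsub>add_monoid G\<^esub> \<and>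
              cl (- p) \<otimes>\<^bsub>add_monoid G\<^esub> x = \<one>\<^bsub>add_monoid G\<^esub>"
            using neg[OF p(1)] T(2) by (auto simp: Gs p(2))
        next
          fix y assume y: "y \<in> carrier (add_monoid G) \<and> x \<otimes>\<^bsub>add_monoid G\<^esub> y = \<one>\<^bsub>add_monoid G\<^esub> \<and>
              y \<otimes>\<^bsub>add_monoid G\<^esub> x = \<one>\<^bsub>add_monoid G\<^esub>"
          then obtain q where q: "y = cl q" by (auto simp: Gs)
          with y have "cl (q + p) = cl 0" by (simp add: Gs p(2))
          then show "y = cl (- p)" by (simp add: q cl_eq)
        qed
        then show ?thesis using neg[OF p(1)] by blast
      qed
      show "r \<odot>\<^bsub>G\<^esub> x \<in> cl ` T" if "x \<in> cl ` T" for r x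
      proof -
        obtain p where p: "p \<in> T" "x = cl p" using \<open>x \<in> cl ` T\<close> by blast
        then have "r \<odot>\<^bsub>G\<^esub> x = cl (poly_scale r p)" using T(2) Gs(4) by blast
        then show ?thesis using T(1) p(1) by (simp add: submod_def)
      qed
    qed
    show "lift (cl ` T) = T"
    proof (intro equalityI subsetI)
      fix p assume "p \<in> lift (cl ` T)"
      then obtain q where q: "p \<in> ?V" "q \<in> T" "cl p = cl q" by (auto simp: lift_def)
      then have "p - q \<in> I \<inter> ?V"
        using T(2) submod_diff[OF V] by (auto simp: cl_eq)
      then have "(p - q) + q \<in> T"
        using T q(2) unfolding submod_def by blast
      then show "p \<in> T" by simp
    qed (use T(2) in \<open>auto simp: lift_def\<close>)
  qed
  let ?L = "\<lambda>T. submod poly_scale T \<and> T \<subseteq> ?V"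
  have "(\<exists>N. (\<forall>i\<le>k. submodule (N i) ?R G) \<and> (\<forall>i<k. N i \<subset> N (Suc i))) \<longleftrightarrow>
      (\<exists>T. (\<forall>i\<le>k. ?L (T i)) \<and> I \<inter> ?V \<subseteq> T 0 \<and> (\<forall>i<k. T i \<subset> T (Suc i)))" for k :: nat
  proof
    assume "\<exists>N. (\<forall>i\<le>k. submodule (N i) ?R G) \<and> (\<forall>i<k. N i \<subset> N (Suc i))"
    then obtain N where N: "\<And>i. i \<le> k \<Longrightarrow> submodule (N i) ?R G" "\<And>i. i < k \<Longrightarrow> N i \<subset> N (Suc i)"
      by blast
    have "lift (N i) \<subset> lift (N (Suc i))" if "i < k" for i
    proof -
      have "lift (N i) \<subseteq> lift (N (Suc i))" using N(2)[OF that] by (auto simp: lift_def)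
      moreover have "cl ` lift (N i) = N i" "cl ` lift (N (Suc i)) = N (Suc i)"
        using that by (auto intro!: lift_image N(1))
      then have "lift (N i) \<noteq> lift (N (Suc i))"
        using N(2)[OF that] by (metis less_irrefl)
      ultimately show ?thesis by blast
    qed
    moreover have "lift (N i) \<subseteq> ?V" for i by (auto simp: lift_def)
    ultimately show "\<exists>T. (\<forall>i\<le>k. ?L (T i)) \<and> I \<inter> ?V \<subseteq> T 0 \<and> (\<forall>i<k. T i \<subset> T (Suc i))"
      using submod_lift[OF N(1)] lift_ge[OF N(1), of 0] by (intro exI[of _ "\<lambda>i. lift (N i)"]) simp
  next
    assume "\<exists>T. (\<forall>i\<le>k. ?L (T i)) \<and> I \<inter> ?V \<subseteq> T 0 \<and> (\<forall>i<k. T i \<subset> T (Suc i))"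
    then obtain T where T: "\<And>i. i \<le> k \<Longrightarrow> ?L (T i)" "I \<inter> ?V \<subseteq> T 0" "\<And>i. i < k \<Longrightarrow> T i \<subset> T (Suc i)"
      by blast
    have ge: "I \<inter> ?V \<subseteq> T i" if "i \<le> k" for i
      using that
    proof (induction i)
      case (Suc i)
      then show ?case using T(3)[of i] by force
    qed (use T(2) in simp)
    have lift_T: "lift (cl ` T i) = T i" if "i \<le> k" for i
      by (rule lift_of_image) (use T(1)[OF that] ge[OF that] in simp_all)
    have "cl ` T i \<subset> cl ` T (Suc i)" if "i < k" for i
    proof -
      have "cl ` T i \<subseteq> cl ` T (Suc i)" using T(3)[OF that] by (intro image_mono) auto
      moreover have "lift (cl ` T i) = T i" "lift (cl ` T (Suc i)) = T (Suc i)"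
        using that lift_T by simp_all
      then have "cl ` T i \<noteq> cl ` T (Suc i)"
        using T(3)[OF that] by (metis less_irrefl)
      ultimately show ?thesis by blast
    qed
    moreover have "submodule (cl ` T i) ?R G" if "i \<le> k" for i
      using submodule_image T(1)[OF that] ge[OF that] by simp
    ultimately show "\<exists>N. (\<forall>i\<le>k. submodule (N i) ?R G) \<and> (\<forall>i<k. N i \<subset> N (Suc i))"
      by (intro exI[of _ "\<lambda>i. cl ` T i"]) simp
  qed
  then show ?thesis
    unfolding module_length_def chain_length_def G_def by simp
qed

lemma hilbert_function_eq_sum_lead:
  fixes I :: "'a::comm_ring_1 mpoly set"
  assumes I: "ideal I (mpoly_ring b)"
  shows "hilbert_function b I n =
    (\<Sum>m | m \<in> monoms {..<b} \<and> monom_degree m = n.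
      chain_length (submod (*)) (lead (I \<inter> homogeneous_polys b n) m))"
proof -
  have "submod poly_scale (I \<inter> homogeneous_polys b n)"
    using ideal_mpolyD(1)[OF I] submod_supported unfolding homogeneous_polys_eq submod_def by blast
  then show ?thesis
    unfolding hilbert_function_def module_length_graded_piece[OF I] homogeneous_polys_eq
    by (intro chain_length_eq_sum_lead) (auto intro: finite_monoms_degree)
qed

section \<open>Hilbert polynomials have Gotzmann developments\<close>

lemma lookup_single_times:
  fixes p :: "mono \<Rightarrow>\<^sub>0 'a::comm_ring_1"
  shows "Poly_Mapping.lookup (Poly_Mapping.single v r * p) (v + u) = r * Poly_Mapping.lookup p u"
proof -
  have "Poly_Mapping.lookup (Poly_Mapping.single v r * p) (v + u) =
      (\<Sum>l. (r when v = l) * (\<Sum>q. Poly_Mapping.lookup p q when v + u = l + q))"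
    by (simp add: lookup_mult lookup_single)
  also have "\<dots> = (\<Sum>l. r * (\<Sum>q. Poly_Mapping.lookup p q when v + u = l + q) when v = l)"
    by (simp add: when_mult)
  also have "\<dots> = r * (\<Sum>q. Poly_Mapping.lookup p q when u = q)"
    by simp
  finally show ?thesis by simp
qed

lemma keys_single_times:
  fixes p :: "mono \<Rightarrow>\<^sub>0 'a::comm_ring_1"
  assumes "k \<in> Poly_Mapping.keys (Poly_Mapping.single v r * p)"
  obtains u where "u \<in> Poly_Mapping.keys p" "k = v + u"
  using keys_mult[of "Poly_Mapping.single v r" p] assms by (auto split: if_splits)

text \<open>Multiplication by the monomial \<open>v\<close> respects the monomial order and carries
  the leading coefficient along unchanged.\<close>

lemma lead_ideal_mono:
  fixes I :: "'a::comm_ring_1 mpoly set"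
  assumes I: "ideal I (mpoly_ring b)" and v: "v \<in> monoms {..<b}"
  shows "lead (I \<inter> homogeneous_polys b n) u
    \<subseteq> lead (I \<inter> homogeneous_polys b (n + monom_degree v)) (u + v)"
proof
  fix r assume "r \<in> lead (I \<inter> homogeneous_polys b n) u"
  then obtain p where p: "p \<in> I" "p \<in> homogeneous_polys b n" "Poly_Mapping.keys p \<subseteq> {..u}"
    "r = Poly_Mapping.lookup p u"
    by (auto elim: leadE)
  let ?q = "Poly_Mapping.single v 1 * p"
  have "Poly_Mapping.single v 1 \<in> carrier (mpoly_ring b)"
    using v by (simp add: mpoly_ring_simps supported_def)
  then have "?q \<in> I" using ideal_mpolyD(3)[OF I] p(1) by blast
  moreover have "?q \<in> homogeneous_polys b (n + monom_degree v)"
    unfolding homogeneous_polys_eq supported_def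
  proof (rule CollectI, rule subsetI)
    fix k assume "k \<in> Poly_Mapping.keys ?q"
    then obtain w where "w \<in> Poly_Mapping.keys p" "k = v + w" by (rule keys_single_times)
    then show "k \<in> {m \<in> monoms {..<b}. monom_degree m = n + monom_degree v}"
      using p(2) v by (auto simp: homogeneous_polys_eq supported_def monoms_def keys_plus_nat monom_degree_add)
  qed
  moreover have "Poly_Mapping.keys ?q \<subseteq> {..u + v}"
  proof
    fix k assume "k \<in> Poly_Mapping.keys ?q"
    then obtain w where "w \<in> Poly_Mapping.keys p" "k = v + w" by (rule keys_single_times)
    then have "w \<le> u" using p(3) by auto
    then have "v + w \<le> v + u" by (rule add_left_mono)
    then show "k \<in> {..u + v}"
      using \<open>k = v + w\<close> by (simp add: add.commute)
  qed
  moreover have "Poly_Mapping.lookup ?q (u + v) = r"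
    using lookup_single_times[of v 1 p u] by (simp add: p(4) add.commute)
  ultimately show "r \<in> lead (I \<inter> homogeneous_polys b (n + monom_degree v)) (u + v)"
    using leadI[of ?q "I \<inter> homogeneous_polys b (n + monom_degree v)" "u + v"] by simp
qed

lemma exists_divisor_of_degree:
  "k \<le> monom_degree m \<Longrightarrow> \<exists>u v. m = u + v \<and> monom_degree u = k"
proof (induction k)
  case 0
  show ?case by (intro exI[of _ 0] exI[of _ m]) simp
next
  case (Suc k)
  then obtain u v where uv: "m = u + v" "monom_degree u = k" by auto
  then have "0 < monom_degree v" using Suc.prems by (simp add: monom_degree_add)
  then have "v \<noteq> 0" by auto
  then obtain y where "y \<in> Poly_Mapping.keys v" by (metis keys_eq_empty ex_in_conv)
  then have "(v - var y) + var y = v" by (rule minus_var_plus_var)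
  then have "m = (u + var y) + (v - var y)" using uv(1) by (metis add.assoc add.commute)
  moreover have "monom_degree (u + var y) = Suc k" by (simp add: monom_degree_add uv(2))
  ultimately show ?case by blast
qed

lemma gap_free_add: "gap_free A \<Longrightarrow> gap_free B \<Longrightarrow> gap_free (A + B)"
  unfolding gap_free_def by (simp add: ball_Un) (smt (verit, best) case_prodI2 case_prod_conv)

lemma gap_free_sum: "(\<And>j. j \<in> J \<Longrightarrow> gap_free (A j)) \<Longrightarrow> gap_free (\<Sum>j\<in>J. A j)"
proof (induction J rule: infinite_finite_induct)
  case (insert j J)
  then show ?case by (simp add: gap_free_add)
qed (simp_all add: gap_free_def)

lemma pieces_count_sum: "pieces_count (\<Sum>j\<in>J. A j) n = (\<Sum>j\<in>J. pieces_count (A j) n)"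
proof (induction J rule: infinite_finite_induct)
  case (insert j J)
  then show ?case by (simp add: pieces_count_add)
qed (simp_all add: pieces_count_def)

lemma enat_sum: "(\<Sum>x\<in>M. enat (f x)) = enat (\<Sum>x\<in>M. f x)"
  by (induction M rule: infinite_finite_induct) (simp_all add: zero_enat_def)

lemma gotzmann_development_of_hilbert_polynomial:
  fixes I :: "'a::comm_ring_1 mpoly set"
  assumes I: "ideal I (mpoly_ring b)" and P: "is_hilbert_polynomial b I P"
  shows "has_gotzmann_development P"
proof -
  define M where "M n = {m \<in> monoms {..<b}. monom_degree m = n}" for n
  define a where "a m = chain_length (submod (*)) (lead (I \<inter> homogeneous_polys b (monom_degree m)) m)" for m
  have fin: "finite (M n)" for n
    unfolding M_def by (rule finite_monoms_degree) simp
  have H: "hilbert_function b I n = (\<Sum>m\<in>M n. a m)" for n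
    unfolding hilbert_function_eq_sum_lead[OF I] M_def by (intro sum.cong) (auto simp: a_def)
  obtain N where N: "\<And>n. n \<ge> N \<Longrightarrow> \<exists>k. hilbert_function b I n = enat k \<and> poly P (of_nat n) = of_nat k"
    using P unfolding is_hilbert_polynomial_def eventually_sequentially by blast
  have a_antimono: "a (u + v) \<le> a u" if "v \<in> monoms {..<b}" for u v
    unfolding a_def monom_degree_add by (intro chain_length_antimono lead_ideal_mono I that)
  have a_fin: "a m = enat (the_enat (a m))" if m: "m \<in> M n" "n \<ge> N" for m n
  proof -
    have "a m \<le> (\<Sum>m\<in>M n. a m)"
      using fin m(1) by (intro member_le_sum) auto
    moreover obtain k where "(\<Sum>m\<in>M n. a m) = enat k"
      using N[OF m(2)] H by auto
    ultimately have "a m \<noteq> \<infinity>" by (cases "a m") auto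
    then show ?thesis by auto
  qed
  \<comment> \<open>One finite slice bounds all higher degrees: a monomial of degree at least
    \<open>N\<close> is a multiple of one of degree \<open>N\<close>, and \<open>a\<close> decreases
    along multiples. The inserted \<open>0\<close> covers an empty slice.\<close>
  define L where "L = Max (insert 0 ((\<lambda>m. the_enat (a m)) ` M N))"
  have L: "a m \<le> enat L" if m: "m \<in> M n" "n \<ge> N" for m n
  proof -
    have "N \<le> monom_degree m" using m by (simp add: M_def)
    then obtain u v where uv: "m = u + v" "monom_degree u = N"
      using exists_divisor_of_degree by blast
    have u: "u \<in> M N" and v: "v \<in> monoms {..<b}"
      using m(1) uv by (auto simp: M_def monoms_def keys_plus_nat)
    have "the_enat (a u) \<le> L"
      unfolding L_def using fin u by (intro Max_ge) auto
    then have "a u \<le> enat L"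
      using a_fin[OF u order.refl] by (metis enat_ord_simps(1))
    then show ?thesis
      using a_antimono[OF v, of u] unfolding uv(1) by (rule order_trans[rotated])
  qed
  \<comment> \<open>Degrees below \<open>N\<close> may be filled in freely, as counts are compared
    only from \<open>N\<close> on.\<close>
  define \<Omega> where "\<Omega> j = {m \<in> monoms {..<b}. monom_degree m < N \<or> enat j \<le> a m}" for j
  have oi: "order_ideal (\<Omega> j)" for j
    unfolding order_ideal_def
  proof (intro allI impI)
    fix u v assume "u + v \<in> \<Omega> j"
    then show "u \<in> \<Omega> j"
      using a_antimono[of v u]
      by (auto simp: \<Omega>_def monoms_def keys_plus_nat monom_degree_add intro: order_trans)
  qed
  have "\<exists>A. (\<forall>n. monom_count (\<Omega> j) n = pieces_count A n) \<and> gap_free A" for j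
    using order_ideal_decomposition[of "{..<b}" "\<Omega> j"] oi by (auto simp: \<Omega>_def)
  then obtain A where A: "\<And>j n. monom_count (\<Omega> j) n = pieces_count (A j) n" "\<And>j. gap_free (A j)"
    by metis
  have "poly P (of_nat n) = of_nat (pieces_count (\<Sum>j\<in>{1..L}. A j) n)" if n: "n \<ge> N" for n
  proof -
    obtain k where k: "hilbert_function b I n = enat k" "poly P (of_nat n) = of_nat k"
      using N[OF n] by blast
    have "enat k = (\<Sum>m\<in>M n. enat (the_enat (a m)))"
      unfolding k(1)[symmetric] H by (rule sum.cong[OF refl]) (rule a_fin[OF _ n])
    then have "k = (\<Sum>m\<in>M n. the_enat (a m))"
      by (simp add: enat_sum)
    \<comment> \<open>A value \<open>e \<le> L\<close> equals the number of levels \<open>j\<close>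
      in \<open>{1..L}\<close> with \<open>j \<le> e\<close>; swapping the sums then counts level by
      level.\<close>
    also have "\<dots> = (\<Sum>m\<in>M n. \<Sum>j\<in>{1..L}. if enat j \<le> a m then 1 else 0)"
    proof (rule sum.cong[OF refl])
      fix m assume m: "m \<in> M n"
      obtain e where e: "a m = enat e" using a_fin[OF m n] by blast
      have "e \<le> L" using L[OF m n] e by simp
      then have "{1..L} \<inter> {j. j \<le> e} = {1..e}" by auto
      then show "the_enat (a m) = (\<Sum>j\<in>{1..L}. if enat j \<le> a m then 1 else 0)"
        by (simp add: e sum.If_cases)
    qed
    also have "\<dots> = (\<Sum>j\<in>{1..L}. \<Sum>m\<in>M n. if enat j \<le> a m then 1 else 0)"
      by (rule sum.swap)
    also have "\<dots> = (\<Sum>j\<in>{1..L}. monom_count (\<Omega> j) n)"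
    proof (rule sum.cong[OF refl])
      fix j
      have "{m \<in> \<Omega> j. monom_degree m = n} = M n \<inter> {m. enat j \<le> a m}"
        using n by (auto simp: \<Omega>_def M_def)
      then show "(\<Sum>m\<in>M n. if enat j \<le> a m then 1 else 0) = monom_count (\<Omega> j) n"
        using fin by (simp add: monom_count_def sum.If_cases)
    qed
    finally show ?thesis
      by (simp add: k(2) A(1) pieces_count_sum)
  qed
  then have "\<forall>\<^sub>F n in sequentially. poly P (of_nat n) = of_nat (pieces_count (\<Sum>j\<in>{1..L}. A j) n)"
    unfolding eventually_sequentially by blast
  then show ?thesis
    by (rule gotzmann_of_pieces) (intro gap_free_sum A(2))
qed

section \<open>Realising a Gotzmann development\<close>

text \<open>Every polynomial is a linear combination of monomials, so closure under monomial
  multiples suffices.\<close>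

lemma ideal_mpolyI:
  fixes I :: "'a::comm_ring_1 mpoly set"
  assumes "I \<subseteq> carrier (mpoly_ring b)" "submod poly_scale I"
    "\<And>v x. v \<in> monoms {..<b} \<Longrightarrow> x \<in> I \<Longrightarrow> Poly_Mapping.single v 1 * x \<in> I"
  shows "ideal I (mpoly_ring b)"
proof -
  interpret ring "mpoly_ring b :: 'a mpoly ring" by (rule ring_mpoly_ring)
  have sum: "(\<Sum>k\<in>K. f k) \<in> I" if "\<And>k. k \<in> K \<Longrightarrow> f k \<in> I" for f and K :: "mono set"
    using that assms(2) by (induction K rule: infinite_finite_induct) (auto simp: submod_def)
  have mult: "p * x \<in> I" if p: "p \<in> carrier (mpoly_ring b)" and x: "x \<in> I" for p x
  proof -
    have "p = (\<Sum>k\<in>Poly_Mapping.keys p. Poly_Mapping.single k (Poly_Mapping.lookup p k))"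
      by (rule poly_mapping_eqI) (simp add: lookup_sum lookup_single when_def in_keys_iff)
    also have "\<dots> = (\<Sum>k\<in>Poly_Mapping.keys p. poly_scale (Poly_Mapping.lookup p k) (Poly_Mapping.single k 1))"
      by (intro sum.cong refl poly_mapping_eqI) (simp add: lookup_single when_def)
    finally have "p * x = (\<Sum>k\<in>Poly_Mapping.keys p. poly_scale (Poly_Mapping.lookup p k) (Poly_Mapping.single k 1 * x))"
      by (metis (no_types, lifting) mult.assoc single_times_eq_poly_scale sum.cong sum_distrib_right)
    also have "\<dots> \<in> I"
    proof (rule sum)
      fix k assume "k \<in> Poly_Mapping.keys p"
      then have "k \<in> monoms {..<b}" using p by (auto simp: mpoly_ring_simps supported_def)
      then show "poly_scale (Poly_Mapping.lookup p k) (Poly_Mapping.single k 1 * x) \<in> I"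
        using assms(2,3) x by (simp add: submod_def)
    qed
    finally show ?thesis .
  qed
  have mult': "x * p \<in> I" if "p \<in> carrier (mpoly_ring b)" "x \<in> I" for p x
    using mult[OF that] by (simp add: mult.commute)
  have minus: "\<ominus>\<^bsub>mpoly_ring b\<^esub> x = - x" if "x \<in> I" for x
  proof (rule minus_equality)
    have "poly_scale (- 1) x \<in> I" using assms(2) that by (simp add: submod_def)
    then show "- x \<in> carrier (mpoly_ring b)" using assms(1) by (auto simp: poly_scale_minus_one)
  qed (use that assms(1) in \<open>auto simp: mpoly_ring_simps\<close>)
  show ?thesis
  proof (rule idealI)
    show "subgroup I (add_monoid (mpoly_ring b))"
    proof
      show "inv\<^bsub>add_monoid (mpoly_ring b)\<^esub> x \<in> I" if "x \<in> I" for x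
      proof -
        have "poly_scale (- 1) x \<in> I" using assms(2) that by (simp add: submod_def)
        then show ?thesis using minus[OF that] by (simp add: a_inv_def poly_scale_minus_one)
      qed
    qed (use assms(1,2) in \<open>auto simp: mpoly_ring_simps submod_def\<close>)
  qed (use mult mult' in \<open>auto simp: mpoly_ring_simps intro: ring_axioms\<close>)
qed

lemma submod_of_ideal:
  assumes "ideal J (ring_of_type_algebra :: 'a::comm_ring_1 ring)"
  shows "submod (*) J"
proof -
  interpret ideal J "ring_of_type_algebra :: 'a ring" by fact
  show ?thesis
    using additive_subgroup.zero_closed[OF is_additive_subgroup]
      additive_subgroup.a_closed[OF is_additive_subgroup] I_l_closed
    by (auto simp: submod_def ring_of_type_algebra_def)
qed

lemma ideal_of_submod:
  assumes "submod (*) J"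
  shows "ideal J (ring_of_type_algebra :: 'a::comm_ring_1 ring)"
proof -
  interpret ring "ring_of_type_algebra :: 'a ring" by (rule ring_from_type_algebra)
  have minus: "\<ominus>\<^bsub>ring_of_type_algebra\<^esub> x = - x" for x :: 'a
    by (rule minus_equality) (simp_all add: ring_of_type_algebra_def)
  have neg: "- x \<in> J" if "x \<in> J" for x
    using assms that unfolding submod_def by (metis mult_minus1)
  have mult: "x * r \<in> J" if "x \<in> J" for r x
    using assms that by (simp add: submod_def mult.commute)
  show ?thesis
  proof (rule idealI)
    show "subgroup J (add_monoid (ring_of_type_algebra :: 'a ring))"
    proof
      show "inv\<^bsub>add_monoid (ring_of_type_algebra :: 'a ring)\<^esub> x \<in> J" if "x \<in> J" for x
        using neg[OF that] minus[of x] by (simp add: a_inv_def)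
    qed (use assms in \<open>auto simp: ring_of_type_algebra_def submod_def\<close>)
  qed (use assms mult in \<open>auto simp: ring_of_type_algebra_def submod_def intro: ring_axioms[unfolded ring_of_type_algebra_def]\<close>)
qed

lemma chain_length_UNIV: "chain_length (submod (*)) (UNIV :: 'a::comm_ring_1 set) = 0"
  by (rule chain_length_eq_0) (auto simp: submod_def)

text \<open>The residue field has length 1: the whole ring is the only ideal strictly above
  \<mm>.\<close>

lemma chain_length_maximal:
  assumes "maximalideal \<mm> (ring_of_type_algebra :: 'a::comm_ring_1 ring)"
  shows "chain_length (submod (*)) \<mm> = 1"
proof -
  interpret maximalideal \<mm> "ring_of_type_algebra :: 'a ring" by fact
  have sub: "submod (*) \<mm>" by (rule submod_of_ideal) (rule is_ideal)
  have ne: "\<mm> \<noteq> UNIV" using I_notcarr by (simp add: ring_of_type_algebra_def)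
  have max: "B = UNIV" if "submod (*) B" "\<mm> \<subset> B" for B
    using I_maximal[OF ideal_of_submod[OF that(1)]] that(2) by (auto simp: ring_of_type_algebra_def)
  have "eSuc (chain_length (submod (*)) (UNIV :: 'a set)) \<le> chain_length (submod (*)) \<mm>"
    using sub ne by (intro chain_length_psubset) (auto simp: submod_def)
  then have "1 \<le> chain_length (submod (*)) \<mm>"
    by (simp add: chain_length_UNIV one_eSuc)
  moreover have "\<not> enat (Suc (Suc 0)) \<le> chain_length (submod (*)) \<mm>"
  proof
    assume "enat (Suc (Suc 0)) \<le> chain_length (submod (*)) \<mm>"
    then obtain B where B: "submod (*) B" "\<mm> \<subset> B" "enat (Suc 0) \<le> chain_length (submod (*)) B"
      by (rule chain_length_step[of "submod (*)", OF sub])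
    show False using B(3) unfolding max[OF B(1,2)] chain_length_UNIV by (simp add: zero_enat_def)
  qed
  ultimately show ?thesis
    by (cases "chain_length (submod (*)) \<mm>") (auto simp: one_enat_def)
qed

lemma lookup_homogeneous_component:
  "Poly_Mapping.lookup (homogeneous_component n p) m =
    (if monom_degree m = n then Poly_Mapping.lookup p m else 0)"
proof -
  have "Poly_Mapping.lookup (homogeneous_component n p) m =
      (\<Sum>k | k \<in> Poly_Mapping.keys p \<and> monom_degree k = n.
        if k = m then Poly_Mapping.lookup p m else 0)"
    unfolding homogeneous_component_def lookup_sum
    by (intro sum.cong) (auto simp: lookup_single when_def)
  then show ?thesis by (auto simp: in_keys_iff)
qed

text \<open>The ideal realising the order ideal \<open>\<Omega>\<close> over a ring with maximal ideal \<open>\<mm>\<close>. Its degree-\<open>0\<close> part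
  is forced to vanish, so the Hilbert function equals that of \<open>\<Omega>\<close> only in positive degrees.\<close>

definition residual_ideal :: "nat \<Rightarrow> mono set \<Rightarrow> 'a::comm_ring_1 set \<Rightarrow> 'a mpoly set" where
  "residual_ideal b \<Omega> \<mm> =
    {p \<in> carrier (mpoly_ring b). Poly_Mapping.lookup p 0 = 0 \<and> (\<forall>m\<in>\<Omega>. Poly_Mapping.lookup p m \<in> \<mm>)}"

lemma ideal_residual_ideal:
  assumes \<Omega>: "order_ideal \<Omega>" and \<mm>: "submod (*) \<mm>"
  shows "ideal (residual_ideal b \<Omega> \<mm>) (mpoly_ring b)"
proof (rule ideal_mpolyI)
  show "residual_ideal b \<Omega> \<mm> \<subseteq> carrier (mpoly_ring b)"
    by (auto simp: residual_ideal_def)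
  show "submod poly_scale (residual_ideal b \<Omega> \<mm>)"
    using \<mm> submod_supported[of "monoms {..<b}"]
    by (auto simp: submod_def residual_ideal_def mpoly_ring_simps lookup_add)
  fix v x assume v: "v \<in> monoms {..<b}" and x: "x \<in> residual_ideal b \<Omega> \<mm>"
  let ?y = "Poly_Mapping.single v 1 * x"
  have cases: "Poly_Mapping.lookup ?y m = 0 \<or> (\<exists>u. m = v + u \<and> Poly_Mapping.lookup ?y m = Poly_Mapping.lookup x u)" for m
  proof (cases "m \<in> Poly_Mapping.keys ?y")
    case True
    then obtain u where "m = v + u" by (rule keys_single_times)
    then show ?thesis using lookup_single_times[of v 1 x u] by auto
  qed (simp add: in_keys_iff)
  have "?y \<in> carrier (mpoly_ring b)"
    unfolding mpoly_ring_simps supported_def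
  proof (rule CollectI, rule subsetI)
    fix k assume "k \<in> Poly_Mapping.keys ?y"
    then obtain u where "u \<in> Poly_Mapping.keys x" "k = v + u" by (rule keys_single_times)
    then show "k \<in> monoms {..<b}"
      using x v by (auto simp: residual_ideal_def mpoly_ring_simps supported_def monoms_def keys_plus_nat)
  qed
  moreover have "Poly_Mapping.lookup ?y 0 = 0"
  proof -
    have "u = 0" if "0 = v + u" for u
      using that monom_degree_add[of v u] by (simp flip: that)
    then show ?thesis using cases[of 0] x unfolding residual_ideal_def by force
  qed
  moreover have "Poly_Mapping.lookup ?y m \<in> \<mm>" if m: "m \<in> \<Omega>" for m
  proof -
    \<comment> \<open>Divisors of monomials in the order ideal stay in it, so the coefficient of
      \<open>x\<close> at \<open>u\<close> already lies in \<open>\<mm>\<close>.\<close>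
    have "u \<in> \<Omega>" if "m = v + u" for u
      using \<Omega> m that unfolding order_ideal_def by (metis add.commute)
    then show ?thesis
      using cases[of m] x \<mm> by (auto simp: residual_ideal_def submod_def)
  qed
  ultimately show "?y \<in> residual_ideal b \<Omega> \<mm>"
    by (simp add: residual_ideal_def)
qed

lemma standard_presentation_residual_ideal:
  assumes "b \<ge> 1" "order_ideal \<Omega>" "submod (*) \<mm>"
  shows "standard_presentation b (residual_ideal b \<Omega> \<mm>)"
  unfolding standard_presentation_def homogeneous_ideal_def
proof (intro conjI ballI allI)
  show "ideal (residual_ideal b \<Omega> \<mm>) (mpoly_ring b)"
    by (rule ideal_residual_ideal[OF assms(2,3)])
next
  fix p n assume p: "p \<in> residual_ideal b \<Omega> \<mm>"
  have "Poly_Mapping.keys (homogeneous_component n p) \<subseteq> Poly_Mapping.keys p"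
    by (auto simp: in_keys_iff lookup_homogeneous_component split: if_splits)
  then show "homogeneous_component n p \<in> residual_ideal b \<Omega> \<mm>"
    using p assms(3)
    by (auto simp: residual_ideal_def mpoly_ring_simps supported_def lookup_homogeneous_component submod_def)
next
  show "residual_ideal b \<Omega> \<mm> \<subseteq> irrelevant_ideal b"
    by (auto simp: residual_ideal_def irrelevant_ideal_def lookup_homogeneous_component intro!: poly_mapping_eqI)
qed (rule assms(1))

text \<open>Membership is a condition on each coefficient separately, so the single term
  \<open>single m r\<close> realises every admissible \<open>r\<close>. Degree 0 is excluded because
  constant terms are forced to vanish.\<close>

lemma lead_residual_ideal:
  assumes "m \<in> monoms {..<b}" "monom_degree m = n" "n > 0" and z: "0 \<in> \<mm>"
  shows "lead (residual_ideal b \<Omega> \<mm> \<inter> homogeneous_polys b n) m = {r. m \<in> \<Omega> \<longrightarrow> r \<in> \<mm>}"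
proof (intro equalityI subsetI)
  fix r assume "r \<in> lead (residual_ideal b \<Omega> \<mm> \<inter> homogeneous_polys b n) m"
  then show "r \<in> {r. m \<in> \<Omega> \<longrightarrow> r \<in> \<mm>}"
    by (auto elim!: leadE simp: residual_ideal_def)
next
  fix r assume r: "r \<in> {r. m \<in> \<Omega> \<longrightarrow> r \<in> \<mm>}"
  show "r \<in> lead (residual_ideal b \<Omega> \<mm> \<inter> homogeneous_polys b n) m"
  proof -
    have "m \<noteq> 0" using assms(2,3) by auto
    then have "Poly_Mapping.single m r \<in> residual_ideal b \<Omega> \<mm> \<inter> homogeneous_polys b n" (is "?s \<in> ?S")
      using assms r z
      by (auto simp: residual_ideal_def homogeneous_polys_eq mpoly_ring_simps supported_def
          lookup_single when_def)
    moreover have "Poly_Mapping.keys ?s \<subseteq> {..m}" by auto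
    ultimately have "Poly_Mapping.lookup ?s m \<in> lead ?S m" by (rule leadI)
    then show ?thesis by simp
  qed
qed

text \<open>A monomial in the order ideal contributes the length 1 of the residue field; outside it
  the leading ideal is the whole ring and contributes 0.\<close>

lemma hilbert_function_residual_ideal:
  fixes \<mm> :: "'a::comm_ring_1 set"
  assumes "order_ideal \<Omega>" "\<Omega> \<subseteq> monoms {..<b}" "n > 0"
    and \<mm>: "maximalideal \<mm> (ring_of_type_algebra :: 'a ring)"
  shows "hilbert_function b (residual_ideal b \<Omega> \<mm>) n = enat (monom_count \<Omega> n)"
proof -
  have sub: "submod (*) \<mm>"
    using \<mm> by (intro submod_of_ideal) (rule maximalideal.axioms(1))
  let ?M = "{m \<in> monoms {..<b}. monom_degree m = n}"
  have "hilbert_function b (residual_ideal b \<Omega> \<mm>) n = (\<Sum>m\<in>?M. enat (if m \<in> \<Omega> then 1 else 0))"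
    unfolding hilbert_function_eq_sum_lead[OF ideal_residual_ideal[OF assms(1) sub]]
    by (intro sum.cong refl)
      (auto simp: lead_residual_ideal assms(3) sub[unfolded submod_def] chain_length_UNIV chain_length_maximal[OF \<mm>]
        one_enat_def zero_enat_def)
  also have "\<dots> = enat (card (?M \<inter> \<Omega>))"
    by (simp add: enat_sum sum.If_cases finite_monoms_degree)
  also have "?M \<inter> \<Omega> = {m \<in> \<Omega>. monom_degree m = n}"
    using assms(2) by auto
  finally show ?thesis by (simp add: monom_count_def)
qed

theorem theorem4p4:
  fixes P :: "rat poly"
  assumes "P \<in> eventually_nat_polys"
    and "equichar_artinian_local_ring (ring_of_type_algebra :: 'a::comm_ring_1 ring)"
  shows "(\<exists>(b::nat) (I :: 'a mpoly set). standard_presentation b I \<and> is_hilbert_polynomial b I P)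
    \<longleftrightarrow> has_gotzmann_development P"
proof
  assume "\<exists>(b::nat) (I :: 'a mpoly set). standard_presentation b I \<and> is_hilbert_polynomial b I P"
  then show "has_gotzmann_development P"
    using gotzmann_development_of_hilbert_polynomial
    by (auto simp: standard_presentation_def homogeneous_ideal_def)
next
  assume "has_gotzmann_development P"
  then obtain cs where cs: "sorted_wrt (\<ge>) cs"
    "\<forall>\<^sub>F n in sequentially. poly P (of_nat n) = (\<Sum>i<length cs. piece_val (i, cs ! i) (of_nat n))"
    by (rule gotzmann_development_list)
  obtain \<mm> where \<mm>: "maximalideal \<mm> (ring_of_type_algebra :: 'a ring)"
    using assms(2) unfolding equichar_artinian_local_ring_def local_ring_def local_ring_axioms_def
    by blast
  have sub: "submod (*) \<mm>"
    using \<mm> by (intro submod_of_ideal) (rule maximalideal.axioms(1))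
  \<comment> \<open>Each entry is at most \<open>sum_list cs\<close>, and \<open>lex_set\<close>
    uses one index beyond an entry, so indices up to \<open>Suc (sum_list cs)\<close> occur at most.
    The bound is also positive for the empty list.\<close>
  let ?\<Omega> = "lex_set cs" and ?b = "Suc (Suc (sum_list cs))"
  have oi: "order_ideal ?\<Omega>" by (rule order_ideal_lex_set[OF cs(1)])
  have "?\<Omega> \<subseteq> monoms {..Suc (sum_list cs)}"
    by (rule lex_set_subset_monoms) (simp add: member_le_sum_list)
  then have \<Omega>_sub: "?\<Omega> \<subseteq> monoms {..<?b}"
    by (simp add: lessThan_Suc_atMost)
  have "is_hilbert_polynomial ?b (residual_ideal ?b ?\<Omega> \<mm>) P"
    unfolding is_hilbert_polynomial_def
    \<comment> \<open>Positive degree avoids the suppressed constants, and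
      \<open>length cs \<le> n\<close> makes the count agree with the polynomial values.\<close>
    using cs(2) eventually_gt_at_top[of 0] eventually_ge_at_top[of "length cs"]
  proof eventually_elim
    case (elim n)
    then show ?case
      using hilbert_function_residual_ideal[OF oi \<Omega>_sub _ \<mm>, of n] monom_count_lex_set[OF cs(1), of n]
      by (intro exI[of _ "monom_count ?\<Omega> n"]) simp
  qed
  moreover have "standard_presentation ?b (residual_ideal ?b ?\<Omega> \<mm>)"
    by (rule standard_presentation_residual_ideal[OF _ oi sub]) simp
  ultimately show "\<exists>(b::nat) (I :: 'a mpoly set). standard_presentation b I \<and> is_hilbert_polynomial b I P"
    by blast
qed

end
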